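(* Let $q\geq 4$ be an even natural number, let $n=q^2+q+1$, let $a\in\{-1,0,\dots,\frac{q}{2}+1\}$ and let $m_a=n+q-a$. If a projective plane $\Pi_q$ of order $q$ exists, then \[\psi(m_a)\geq (m_a-a)q.\]
   Context: A vertex-colouring of a graph $G$ (not necessarily proper) is complete if for every pair of distinct colours used there are two adjacent vertices of $G$ carrying these two colours. The pseudoachromatic number $\psi(G)$ is the maximum number of colours in a complete vertex-colouring of $G$. For a positive integer $m$, $\psi(m):=\psi(L(K_m))$, where $L(K_m)$ is the line graph of the complete graph $K_m$. Equivalently, $\psi(m)$ is the maximum number of colours in an edge-colouring of $K_m$ (not necessarily proper) such that for every pair of distinct colours used there is a vertex of $K_m$ incident with edges of both colours. A projective plane consists of a set of points, a set of lines, and an incidence relation such that any two distinct points are incident with exactly one common line, any two distinct lines are incident with exactly one common point, and there are four points such that no line is incident with more than two of them. It has order $q$ if it has $q^2+q+1$ points and $q^2+q+1$ lines, with each line containing $q+1$ points and each point belonging to $q+1$ lines. *)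

theory Defs
  imports Main
begin

text \<open>A simple graph is a pair of a vertex set and a set of edges, an edge being a
  two-element set of vertices.\<close>

type_synonym 'a graph = "'a set \<times> 'a set set"

definition simple_graph :: "'a graph \<Rightarrow> bool" where
  "simple_graph G \<longleftrightarrow> (\<forall>e\<in>snd G. e \<subseteq> fst G \<and> card e = 2)"

definition adjacent :: "'a graph \<Rightarrow> 'a \<Rightarrow> 'a \<Rightarrow> bool" where
  "adjacent G u v \<longleftrightarrow> {u, v} \<in> snd G"

definition complete_graph :: "nat \<Rightarrow> nat graph" where
  "complete_graph m = ({..<m}, {e. e \<subseteq> {..<m} \<and> card e = 2})"

definition line_graph :: "'a graph \<Rightarrow> 'a set graph" where
  "line_graph G = (snd G, {{e, f} |e f. e \<in> snd G \<and> f \<in> snd G \<and> e \<noteq> f \<and> e \<inter> f \<noteq> {}})"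

definition complete_colouring :: "'a graph \<Rightarrow> ('a \<Rightarrow> 'c) \<Rightarrow> bool" where
  "complete_colouring G c \<longleftrightarrow>
     (\<forall>i\<in>c ` fst G. \<forall>j\<in>c ` fst G. i \<noteq> j \<longrightarrow>
        (\<exists>u\<in>fst G. \<exists>v\<in>fst G. adjacent G u v \<and> c u = i \<and> c v = j))"

text \<open>Only meaningful for finite graphs: there the set below is finite and nonempty
  (lemmas below), and natural numbers suffice as colours.\<close>

definition pseudoachromatic_number :: "'a graph \<Rightarrow> nat" where
  "pseudoachromatic_number G = Max {card (c ` fst G) |c :: 'a \<Rightarrow> nat. complete_colouring G c}"

definition psi :: "nat \<Rightarrow> nat" where
  "psi m = pseudoachromatic_number (line_graph (complete_graph m))"

locale projective_plane =
  fixes points :: "'p set" and lines :: "'l set" and incident :: "'p \<Rightarrow> 'l \<Rightarrow> bool"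
  assumes joining_line:
    "\<lbrakk>x \<in> points; y \<in> points; x \<noteq> y\<rbrakk> \<Longrightarrow> \<exists>!l. l \<in> lines \<and> incident x l \<and> incident y l"
  and meeting_point:
    "\<lbrakk>l \<in> lines; k \<in> lines; l \<noteq> k\<rbrakk> \<Longrightarrow> \<exists>!x. x \<in> points \<and> incident x l \<and> incident x k"
  and quadrangle:
    "\<exists>Q. Q \<subseteq> points \<and> card Q = 4 \<and> (\<forall>l\<in>lines. card {x \<in> Q. incident x l} \<le> 2)"

locale projective_plane_of_order = projective_plane points lines incident
  for points :: "'p set" and lines :: "'l set" and incident :: "'p \<Rightarrow> 'l \<Rightarrow> bool" +
  fixes q :: nat
  assumes card_points: "card points = q^2 + q + 1"
  and card_lines: "card lines = q^2 + q + 1"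
  and points_on_line: "l \<in> lines \<Longrightarrow> card {x \<in> points. incident x l} = q + 1"
  and lines_through_point: "x \<in> points \<Longrightarrow> card {l \<in> lines. incident x l} = q + 1"

lemma simple_graph_complete_graph: "simple_graph (complete_graph m)"
  by (simp add: simple_graph_def complete_graph_def)

lemma simple_graph_line_graph: "simple_graph (line_graph G)"
  by (fastforce simp: simple_graph_def line_graph_def card_2_iff)

lemma finite_line_graph_complete_graph: "finite (fst (line_graph (complete_graph m)))"
  by (simp add: line_graph_def complete_graph_def)

lemma complete_colouring_const: "complete_colouring G (\<lambda>_. k)"
  by (auto simp: complete_colouring_def)

lemma finite_colour_counts:
  assumes "finite (fst G)"
  shows "finite {card (c ` fst G) |c :: 'a \<Rightarrow> nat. complete_colouring G c}"
proof (rule finite_subset)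
  show "{card (c ` fst G) |c :: 'a \<Rightarrow> nat. complete_colouring G c} \<subseteq> {..card (fst G)}"
    using assms by (auto intro: card_image_le)
qed simp

lemma nonempty_colour_counts:
  "{card (c ` fst G) |c :: 'a \<Rightarrow> nat. complete_colouring G c} \<noteq> {}"
  using complete_colouring_const[of G 0] by blast

end

theory Submission
  imports Defs "HOL-Library.Disjoint_Sets"
begin

text \<open>
  Write \<open>q = 2 * h\<close>. The vertices of the complete graph are the points of the plane together with a
  set \<open>W\<close> of \<open>q - a\<close> further vertices. Many colours in a complete colouring amount to many pairwise
  disjoint edge classes, any two of which have a common vertex. To force common vertices, every
  class is made to cover a prescribed vertex set. For almost all classes this set contains all
  points of some line, because any two lines share a point.

  A line has an odd number of points, so the complete graph on it splits into \<open>q + 1\<close> matchings, each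
  missing one point, and a matching becomes a class covering the line as soon as it receives one
  more edge at the point it misses. Such edges come from three sources: edges to \<open>W\<close>, the edges of
  a matching that is given up, and spare edges inside other lines.

  For \<open>a = -1\<close> every point has exactly one edge to \<open>W\<close> for each line through it, so every line carries
  \<open>q + 1\<close> classes. All of them reach \<open>W\<close>, and the complete graph on \<open>W\<close> contributes \<open>q - 1\<close> classes
  covering \<open>W\<close>. This is \<open>psi_bound_long\<close>.

  For \<open>a \<ge> 0\<close> fix two lines \<open>l0\<close>, \<open>m0\<close> through a point \<open>x0\<close>, a set \<open>F\<close> of \<open>q - a\<close> points of \<open>l0\<close> other than
  \<open>x0\<close>, and a set \<open>R\<close> of \<open>a\<close> points of \<open>m0\<close> other than \<open>x0\<close>. Put \<open>X = l0 - F\<close>. A line avoiding \<open>x0\<close> is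
  determined by its points \<open>z\<close> on \<open>l0\<close> and \<open>y\<close> on \<open>m0\<close>, and it carries \<open>q\<close> classes, one more if
  \<open>z \<in> F\<close>, one less if \<open>y \<in> R\<close>. The other lines through \<open>x0\<close> carry \<open>q - 1\<close> classes, and both \<open>l0\<close> and
  the set \<open>W \<union> X\<close> carry \<open>q\<close> classes. The total is \<open>(m - a) * q\<close>. Two classes meet: a line class with
  \<open>z \<in> F\<close> reaches \<open>W\<close>, and every other line class contains a point of \<open>X\<close>.

  The edges are found as follows. If \<open>z \<in> F\<close>, the points of the line other than \<open>z\<close> use their edges
  to the vertex of \<open>W\<close> assigned to \<open>z\<close>. What remains of the line is the matching that misses \<open>z\<close>. If
  \<open>y \<notin> R\<close>, it is completed by an edge from \<open>z\<close> to \<open>W\<close>, and if \<open>y \<in> R\<close>, its \<open>h\<close> edges are lent, each at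
  one of its ends. If \<open>z \<notin> F\<close> and \<open>y \<notin> R\<close>, one matching is given up and completes only half of the
  others, so the line borrows at \<open>h\<close> of its points. All remaining lines except \<open>l0\<close> give up two
  matchings, whose edges complete the others with one edge to spare, and lend that edge at their
  point in \<open>X\<close>. These last loans go to \<open>l0\<close> and \<open>W \<union> X\<close>: each edge inside \<open>X\<close> can be
  used by only one of them, and on both only \<open>h\<close> of the \<open>q\<close> classes contain edges at \<open>x0\<close>.

  Such debts and credits are recorded vertex by vertex in the notion of a scheme, and
  \<open>psi_ge_sum_schemes\<close> says that balanced schemes yield a colouring. The geometric core is
  \<open>ex_balanced_loans\<close>: the lending and borrowing points on the lines avoiding \<open>x0\<close> can be chosen so that
  at no point more is borrowed than lent.
\<close>

section \<open>Edge classes with debts and credits\<close>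

definition pairs :: "'v set \<Rightarrow> 'v set set" where
  "pairs A = {e. e \<subseteq> A \<and> card e = 2}"

lemma doubleton_in_pairs [simp]: "{u, v} \<in> pairs A \<longleftrightarrow> u \<in> A \<and> v \<in> A \<and> u \<noteq> v"
  by (auto simp: pairs_def card_2_iff)

lemma pairsE:
  assumes "e \<in> pairs A"
  obtains u v where "e = {u, v}" "u \<in> A" "v \<in> A" "u \<noteq> v"
  using assms by (auto simp: pairs_def card_2_iff)

lemma pairs_mono: "A \<subseteq> B \<Longrightarrow> pairs A \<subseteq> pairs B"
  by (auto simp: pairs_def)

lemma finite_pairs: "finite A \<Longrightarrow> finite (pairs A)"
  by (auto simp: pairs_def)

text \<open>Edges outside all classes get the colour of some class, which cannot destroy completeness. Two
  edges from different classes are distinct, so a common vertex makes them adjacent in the line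
  graph.\<close>

lemma psi_ge_card_classes:
  fixes C :: "'i \<Rightarrow> 'v set set"
  assumes V: "finite V" and I: "finite I"
    and sub: "\<And>i. i \<in> I \<Longrightarrow> C i \<subseteq> pairs V"
    and disj: "disjoint_family_on C I"
    and ne: "\<And>i. i \<in> I \<Longrightarrow> C i \<noteq> {}"
    and meet: "\<And>i j. i \<in> I \<Longrightarrow> j \<in> I \<Longrightarrow> i \<noteq> j \<Longrightarrow> \<exists>e\<in>C i. \<exists>f\<in>C j. e \<inter> f \<noteq> {}"
  shows "card I \<le> psi (card V)"
proof (cases "I = {}")
  case False
  then obtain i0 where i0: "i0 \<in> I" by auto
  define m where "m = card V"
  let ?G = "line_graph (complete_graph m)"
  obtain b where b: "bij_betw b V {..<m}"
    using V ex_bij_betw_finite_nat[of V] by (auto simp: m_def atLeast0LessThan)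
  obtain \<nu> where \<nu>: "bij_betw \<nu> I {..<card I}"
    using I ex_bij_betw_finite_nat[of I] by (auto simp: atLeast0LessThan)
  have inj\<nu>: "inj_on \<nu> I" using \<nu> by (auto simp: bij_betw_def)
  have injb: "inj_on b V" using b by (auto simp: bij_betw_def)
  have verts: "fst ?G = pairs {..<m}"
    by (auto simp: line_graph_def complete_graph_def pairs_def)
  define D where "D i = (\<lambda>e. b ` e) ` C i" for i
  have Dsub: "D i \<subseteq> pairs {..<m}" if "i \<in> I" for i
  proof
    fix e assume "e \<in> D i"
    then obtain e' where e': "e' \<in> C i" "e = b ` e'" by (auto simp: D_def)
    then have "e' \<in> pairs V" using sub that by auto
    then obtain u v where "e' = {u,v}" "u \<in> V" "v \<in> V" "u \<noteq> v" by (rule pairsE)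
    then show "e \<in> pairs {..<m}"
      using e' b injb by (auto simp: bij_betw_def inj_on_def)
  qed
  have Duniq: "i = j" if "i \<in> I" "j \<in> I" "e \<in> D i" "e \<in> D j" for i j e
  proof -
    obtain e1 e2 where e: "e1 \<in> C i" "e = b ` e1" "e2 \<in> C j" "e = b ` e2"
      using \<open>e \<in> D i\<close> \<open>e \<in> D j\<close> by (auto simp: D_def)
    have "e1 \<subseteq> V" "e2 \<subseteq> V" using e sub that by (force simp: pairs_def)+
    then have "e1 = e2" using e injb by (metis inj_on_image_eq_iff)
    then show ?thesis using e that disj by (fastforce simp: disjoint_family_on_def)
  qed
  define c where "c e = (if \<exists>i\<in>I. e \<in> D i then \<nu> (SOME i. i \<in> I \<and> e \<in> D i) else \<nu> i0)" for e
  have c: "c e = \<nu> i" if "i \<in> I" "e \<in> D i" for e i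
  proof -
    have "(SOME i. i \<in> I \<and> e \<in> D i) = i"
      using that Duniq by (intro some_equality) auto
    then show ?thesis using that by (auto simp: c_def)
  qed
  have "c e \<in> \<nu> ` I" for e
  proof (cases "\<exists>i\<in>I. e \<in> D i")
    case True
    then show ?thesis using c by auto
  qed (use i0 in \<open>auto simp: c_def\<close>)
  moreover have "\<nu> i \<in> c ` fst ?G" if i: "i \<in> I" for i
  proof -
    obtain e where "e \<in> D i" using ne[OF i] by (auto simp: D_def)
    then show ?thesis using c[OF i] Dsub[OF i] verts by (metis imageI subsetD)
  qed
  ultimately have im: "c ` fst ?G = \<nu> ` I" by blast
  have "complete_colouring ?G c"
    unfolding complete_colouring_def im
  proof (intro ballI impI)
    fix x y assume "x \<in> \<nu> ` I" "y \<in> \<nu> ` I" "x \<noteq> y"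
    then obtain i j where ij: "i \<in> I" "j \<in> I" "i \<noteq> j" "x = \<nu> i" "y = \<nu> j" by auto
    obtain e f where ef: "e \<in> C i" "f \<in> C j" "e \<inter> f \<noteq> {}" using meet[OF ij(1-3)] by blast
    have D: "b ` e \<in> D i" "b ` f \<in> D j" using ef by (auto simp: D_def)
    have "b ` e \<in> pairs {..<m}" "b ` f \<in> pairs {..<m}"
      using subsetD[OF Dsub[OF ij(1)] D(1)] subsetD[OF Dsub[OF ij(2)] D(2)] .
    moreover have "b ` e \<noteq> b ` f" using D Duniq[OF ij(1,2)] ij(3) by auto
    moreover have "b ` e \<inter> b ` f \<noteq> {}" using ef by blast
    ultimately have "adjacent ?G (b ` e) (b ` f)"
      unfolding adjacent_def line_graph_def complete_graph_def pairs_def snd_conv mem_Collect_eq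
      by blast
    then show "\<exists>u\<in>fst ?G. \<exists>v\<in>fst ?G. adjacent ?G u v \<and> c u = x \<and> c v = y"
      using D c[OF ij(1) D(1)] c[OF ij(2) D(2)] ij subsetD[OF Dsub[OF ij(1)] D(1)]
        subsetD[OF Dsub[OF ij(2)] D(2)] unfolding verts by blast
  qed
  then have "card (c ` fst ?G) \<in> {card (c ` fst ?G) |c :: nat set \<Rightarrow> nat. complete_colouring ?G c}"
    by blast
  then have "card (c ` fst ?G) \<le> psi m"
    unfolding psi_def pseudoachromatic_number_def
    by (intro Max_ge finite_colour_counts finite_line_graph_complete_graph)
  then show ?thesis using im inj\<nu> by (simp add: card_image m_def)
qed simp

text \<open>A scheme splits part of the edge set \<open>E\<close> into \<open>k\<close> classes, each of which should cover a vertex set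
  from \<open>\<K>\<close>. The classes may be unfinished: up to \<open>d v\<close> of them still lack an edge at \<open>v\<close>. In return, at
  least \<open>g v\<close> edges at \<open>v\<close> are spare. A spare edge is reserved for only one of its ends, so credits at
  different vertices never compete.\<close>

definition scheme :: "'v set set \<Rightarrow> nat \<Rightarrow> 'v set set \<Rightarrow> ('v \<Rightarrow> nat) \<Rightarrow> ('v \<Rightarrow> nat) \<Rightarrow> bool" where
  "scheme E k \<K> d g \<longleftrightarrow> (\<exists>C K G.
     (\<forall>i<k. C i \<subseteq> E \<and> K i \<in> \<K>) \<and> disjoint_family_on C {..<k} \<and>
     (\<forall>v. G v \<subseteq> E \<and> finite (G v) \<and> g v \<le> card (G v) \<and> (\<forall>e\<in>G v. v \<in> e)) \<and> disjoint_family G \<and>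
     (\<forall>i<k. \<forall>v. C i \<inter> G v = {}) \<and>
     (\<forall>v. card {i. i < k \<and> v \<in> K i \<and> v \<notin> \<Union>(C i)} \<le> d v))"

text \<open>Debts at \<open>v\<close> and credits at \<open>v\<close> may belong to different schemes. If there are at least as many
  credits as debts at every vertex, each unfinished class can be handed its own spare edge. The
  finished classes cover the prescribed sets, which pairwise intersect. Taking both sets from the
  same class shows that they are nonempty.\<close>

lemma psi_ge_sum_schemes:
  fixes E :: "'s \<Rightarrow> 'v set set"
  assumes V: "finite V" and S: "finite S"
    and sub: "\<And>s. s \<in> S \<Longrightarrow> E s \<subseteq> pairs V"
    and disj: "disjoint_family_on E S"
    and schemes: "\<And>s. s \<in> S \<Longrightarrow> scheme (E s) (k s) (\<K> s) (d s) (g s)"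
    and balance: "\<And>v. (\<Sum>s\<in>S. d s v) \<le> (\<Sum>s\<in>S. g s v)"
    and meet: "\<And>s t A B. s \<in> S \<Longrightarrow> t \<in> S \<Longrightarrow> A \<in> \<K> s \<Longrightarrow> B \<in> \<K> t \<Longrightarrow> A \<inter> B \<noteq> {}"
  shows "(\<Sum>s\<in>S. k s) \<le> psi (card V)"
proof -
  let ?R = "\<lambda>s C K G.
     (\<forall>i<k s. C i \<subseteq> E s \<and> K i \<in> \<K> s) \<and> disjoint_family_on C {..<k s} \<and>
     (\<forall>v. G v \<subseteq> E s \<and> finite (G v) \<and> g s v \<le> card (G v) \<and> (\<forall>e\<in>G v. v \<in> e)) \<and> disjoint_family G \<and>
     (\<forall>i<k s. \<forall>v. C i \<inter> G v = {}) \<and>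
     (\<forall>v. card {i. i < k s \<and> v \<in> K i \<and> v \<notin> \<Union>(C i)} \<le> d s v)"
  have "\<forall>s\<in>S. \<exists>C K G. ?R s C K G"
    using schemes by (simp add: scheme_def)
  then obtain C where "\<forall>s\<in>S. \<exists>K G. ?R s (C s) K G" by (rule bchoice[THEN exE])
  then obtain K where "\<forall>s\<in>S. \<exists>G. ?R s (C s) (K s) G" by (rule bchoice[THEN exE])
  then obtain G where R: "\<forall>s\<in>S. ?R s (C s) (K s) (G s)" by (rule bchoice[THEN exE])
  have CK: "\<And>s i. s \<in> S \<Longrightarrow> i < k s \<Longrightarrow> C s i \<subseteq> E s \<and> K s i \<in> \<K> s"
    and Cd: "\<And>s. s \<in> S \<Longrightarrow> disjoint_family_on (C s) {..<k s}"
    and G: "\<And>s v. s \<in> S \<Longrightarrow> G s v \<subseteq> E s \<and> finite (G s v) \<and> g s v \<le> card (G s v) \<and> (\<forall>e\<in>G s v. v \<in> e)"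
    and Gd: "\<And>s. s \<in> S \<Longrightarrow> disjoint_family (G s)"
    and CG: "\<And>s i v. s \<in> S \<Longrightarrow> i < k s \<Longrightarrow> C s i \<inter> G s v = {}"
    and debt: "\<And>s v. s \<in> S \<Longrightarrow> card {i. i < k s \<and> v \<in> K s i \<and> v \<notin> \<Union>(C s i)} \<le> d s v"
    using R by simp_all
  have E_unique: "s = t" if "s \<in> S" "t \<in> S" "e \<in> E s" "e \<in> E t" for s t e
    using disj that by (fastforce simp: disjoint_family_on_def)
  define I where "I = Sigma S (\<lambda>s. {..<k s})"
  have finI: "finite I" using S by (auto simp: I_def)
  define D where "D v = {(s, i) \<in> I. v \<in> K s i \<and> v \<notin> \<Union>(C s i)}" for v
  define H where "H v = (\<Union>s\<in>S. G s v)" for v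
  have "\<exists>f. inj_on f (D v) \<and> f ` D v \<subseteq> H v" for v
  proof -
    have "D v = Sigma S (\<lambda>s. {i. i < k s \<and> v \<in> K s i \<and> v \<notin> \<Union>(C s i)})"
      by (auto simp: D_def I_def)
    then have "card (D v) = (\<Sum>s\<in>S. card {i. i < k s \<and> v \<in> K s i \<and> v \<notin> \<Union>(C s i)})"
      using S by simp
    also have "\<dots> \<le> (\<Sum>s\<in>S. d s v)" using debt by (intro sum_mono) auto
    also have "\<dots> \<le> (\<Sum>s\<in>S. g s v)" by (rule balance)
    also have "\<dots> \<le> (\<Sum>s\<in>S. card (G s v))" using G by (intro sum_mono) auto
    also have "\<dots> = card (H v)"
      unfolding H_def
    proof (rule card_UN_disjoint[symmetric])
      show "\<forall>s\<in>S. \<forall>t\<in>S. s \<noteq> t \<longrightarrow> G s v \<inter> G t v = {}"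
        by (meson E_unique G disjoint_iff subsetD)
    qed (use S G in auto)
    finally have "card (D v) \<le> card (H v)" .
    moreover have "finite (D v)" using finI by (rule finite_subset[rotated]) (auto simp: D_def)
    moreover have "finite (H v)" using S G by (auto simp: H_def)
    ultimately show ?thesis using card_le_inj[of "D v" "H v"] by blast
  qed
  \<comment> \<open>The spare edge that a class with a debt at the vertex receives there.\<close>
  then obtain f where f: "\<And>v. inj_on (f v) (D v)" "\<And>v. f v ` D v \<subseteq> H v" by metis
  define C' where "C' x = C (fst x) (snd x) \<union> {f v x |v. x \<in> D v}" for x
  have H: "e \<in> pairs V" "v \<in> e" if "e \<in> H v" for e v
    using that G sub unfolding H_def by blast+
  have HC: False if HC: "e \<in> H v" "e \<in> C s i" "s \<in> S" "i < k s" for e v s i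
  proof -
    obtain t where t: "t \<in> S" "e \<in> G t v" using HC by (auto simp: H_def)
    then have "e \<in> E t" "e \<in> E s" using G[of t v] CK[of s i] that by auto
    then have "s = t" using E_unique t that by auto
    then show False using CG[of s i v] that t by auto
  qed
  have HH: "u = v" if HH: "e \<in> H u" "e \<in> H v" for e u v
  proof -
    obtain s t where st: "s \<in> S" "t \<in> S" "e \<in> G s u" "e \<in> G t v" using HH by (auto simp: H_def)
    then have "e \<in> E s" "e \<in> E t" using G[of s u] G[of t v] by auto
    then have "s = t" using E_unique st by auto
    then have "disjoint_family (G s)" "e \<in> G s u" "e \<in> G s v"
      using Gd st by auto
    then show ?thesis by (auto simp: disjoint_family_on_def)
  qed
  have cover: "\<exists>e\<in>C' x. v \<in> e" if "x \<in> I" "v \<in> K (fst x) (snd x)" for x v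
  proof (cases "x \<in> D v")
    case True
    then have "f v x \<in> C' x" "f v x \<in> H v" using f by (auto simp: C'_def)
    then show ?thesis using H by blast
  next
    case False
    then show ?thesis using that by (auto simp: D_def C'_def split: prod.splits)
  qed
  have "card I \<le> psi (card V)"
  proof (rule psi_ge_card_classes[OF V finI, of C'])
    fix x assume x: "x \<in> I"
    obtain s i where si: "x = (s, i)" "s \<in> S" "i < k s" using x by (auto simp: I_def)
    have "C s i \<subseteq> pairs V" using CK[OF si(2,3)] sub[OF si(2)] by auto
    moreover have "f v x \<in> pairs V" if "x \<in> D v" for v
      using f(2)[of v] that by (intro H(1)[of _ v]) auto
    ultimately show "C' x \<subseteq> pairs V" by (auto simp: C'_def si)
    have "K (fst x) (snd x) \<inter> K (fst x) (snd x) \<noteq> {}"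
      using CK[OF si(2,3)] si by (intro meet[of "fst x" "fst x"]) auto
    then obtain v where "v \<in> K (fst x) (snd x)" by blast
    then show "C' x \<noteq> {}" using cover[OF x, of v] by auto
    fix y assume y: "y \<in> I"
    obtain t j where tj: "y = (t, j)" "t \<in> S" "j < k t" using y by (auto simp: I_def)
    have "K (fst x) (snd x) \<inter> K (fst y) (snd y) \<noteq> {}"
      using CK[OF si(2,3)] CK[OF tj(2,3)] si tj by (intro meet[of "fst x" "fst y"]) auto
    then obtain v where "v \<in> K (fst x) (snd x)" "v \<in> K (fst y) (snd y)" by blast
    then show "\<exists>e\<in>C' x. \<exists>g\<in>C' y. e \<inter> g \<noteq> {}"
      using cover[OF x, of v] cover[OF y, of v] by (meson disjoint_iff)
  next
    show "disjoint_family_on C' I"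
      unfolding disjoint_family_on_def
    proof (intro ballI impI)
      fix x y assume xy: "x \<in> I" "y \<in> I" "x \<noteq> y"
      obtain s i t j where st: "x = (s, i)" "y = (t, j)" by (cases x; cases y)
      have s: "s \<in> S" "i < k s" "t \<in> S" "j < k t" using xy st by (auto simp: I_def)
      have "C s i \<inter> C t j = {}"
      proof (cases "s = t")
        case True
        then show ?thesis using Cd[of s] s xy st by (simp add: disjoint_family_on_def)
      next
        case False
        then have "E s \<inter> E t = {}" using disj s by (simp add: disjoint_family_on_def)
        then show ?thesis using CK[of s i] CK[of t j] s by blast
      qed
      moreover have "f v x \<notin> C t j" if "x \<in> D v" for v
        using f(2)[of v] that HC[of "f v x" v t j] s by auto
      moreover have "f v y \<notin> C s i" if "y \<in> D v" for v
        using f(2)[of v] that HC[of "f v y" v s i] s by auto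
      moreover have "f u x \<noteq> f v y" if "x \<in> D u" "y \<in> D v" for u v
      proof
        assume eq: "f u x = f v y"
        have "f u x \<in> H u" "f v y \<in> H v" using f that by auto
        then have "u = v" using eq HH by metis
        then show False using inj_onD[OF f(1)[of v], of x y] eq that xy by auto
      qed
      ultimately show "C' x \<inter> C' y = {}" unfolding C'_def st by auto
    qed
  qed
  then show ?thesis using S by (simp add: I_def)
qed

lemma schemeI:
  assumes J: "finite J" "card J = k"
    and CK: "\<And>j. j \<in> J \<Longrightarrow> C j \<subseteq> E" "\<And>j. j \<in> J \<Longrightarrow> K j \<in> \<K>" "disjoint_family_on C J"
    and G: "\<And>v. G v \<subseteq> E" "\<And>v. finite (G v)" "\<And>v. g v \<le> card (G v)"
      "\<And>v e. e \<in> G v \<Longrightarrow> v \<in> e" "disjoint_family G"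
    and CG: "\<And>j v. j \<in> J \<Longrightarrow> C j \<inter> G v = {}"
    and debt: "\<And>v. card {j \<in> J. v \<in> K j \<and> v \<notin> \<Union>(C j)} \<le> d v"
  shows "scheme E k \<K> d g"
proof -
  obtain b where b: "bij_betw b {..<k} J"
    using ex_bij_betw_nat_finite[OF J(1)] J(2) by (auto simp: atLeast0LessThan)
  have bJ: "b i \<in> J" if "i < k" for i using b that by (auto simp: bij_betw_def)
  have "disjoint_family_on (\<lambda>i. C (b i)) {..<k}"
    unfolding disjoint_family_on_def
  proof (intro ballI impI)
    fix i j assume "i \<in> {..<k}" "j \<in> {..<k}" "i \<noteq> j"
    then have "b i \<noteq> b j" "b i \<in> J" "b j \<in> J"
      using b by (auto simp: bij_betw_def inj_on_def)
    then show "C (b i) \<inter> C (b j) = {}"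
      using CK(3) by (simp add: disjoint_family_on_def)
  qed
  moreover have "card {i. i < k \<and> v \<in> K (b i) \<and> v \<notin> \<Union>(C (b i))} \<le> d v" for v
  proof -
    have "card {i. i < k \<and> v \<in> K (b i) \<and> v \<notin> \<Union>(C (b i))}
        \<le> card {j \<in> J. v \<in> K j \<and> v \<notin> \<Union>(C j)}"
    proof (rule card_inj_on_le)
      show "inj_on b {i. i < k \<and> v \<in> K (b i) \<and> v \<notin> \<Union>(C (b i))}"
        using b by (auto simp: bij_betw_def inj_on_def)
    qed (use J bJ in auto)
    then show ?thesis using debt[of v] by linarith
  qed
  ultimately show ?thesis
    unfolding scheme_def using CK(1,2) G CG bJ
    by (intro exI[of _ "\<lambda>i. C (b i)"] exI[of _ "\<lambda>i. K (b i)"] exI[of _ G]) auto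
qed

lemma scheme_mono:
  assumes "scheme E k \<K> d g" "\<K> \<subseteq> \<K>'" "\<And>v. d v \<le> d' v"
  shows "scheme E k \<K>' d' g"
proof -
  obtain C K G where *: "\<forall>i<k. C i \<subseteq> E \<and> K i \<in> \<K>" "disjoint_family_on C {..<k}"
     "\<forall>v. G v \<subseteq> E \<and> finite (G v) \<and> g v \<le> card (G v) \<and> (\<forall>e\<in>G v. v \<in> e)" "disjoint_family G"
     "\<forall>i<k. \<forall>v. C i \<inter> G v = {}"
     "\<forall>v. card {i. i < k \<and> v \<in> K i \<and> v \<notin> \<Union>(C i)} \<le> d v"
    using assms(1) unfolding scheme_def by (elim exE conjE) (rule that)
  have "\<forall>i<k. C i \<subseteq> E \<and> K i \<in> \<K>'" using *(1) assms(2) by blast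
  moreover have "\<forall>v. card {i. i < k \<and> v \<in> K i \<and> v \<notin> \<Union>(C i)} \<le> d' v"
    using *(6) assms(3) le_trans by blast
  ultimately show ?thesis unfolding scheme_def using *(2-5)
    by (intro exI[of _ C] exI[of _ K] exI[of _ G] conjI)
qed

lemma disjoint_family_on_optionI:
  assumes "\<And>l k. l \<in> I \<Longrightarrow> k \<in> I \<Longrightarrow> l \<noteq> k \<Longrightarrow> E (Some l) \<inter> E (Some k) = {}"
    and "\<And>l. l \<in> I \<Longrightarrow> E None \<inter> E (Some l) = {}"
  shows "disjoint_family_on E (insert None (Some ` I))"
  unfolding disjoint_family_on_def
proof (intro ballI impI)
  fix s t assume "s \<in> insert None (Some ` I)" "t \<in> insert None (Some ` I)" "s \<noteq> t"
  then show "E s \<inter> E t = {}"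
    by (cases s; cases t) (use assms in \<open>auto simp: Int_commute simp del: disjoint_iff_not_equal\<close>)
qed

section \<open>One-factorizations with a missing point, and the classes on a line\<close>

lemma two_mod_odd_inj:
  fixes u v h :: nat
  assumes "u < 2*h+1" "v < 2*h+1" "(2*u) mod (2*h+1) = (2*v) mod (2*h+1)"
  shows "u = v"
proof -
  have "(2*w) mod (2*h+1) = (if w \<le> h then 2*w else 2*w - (2*h+1))" if "w < 2*h+1" for w
    using that by (simp add: le_mod_geq)
  then have "(if u \<le> h then 2*u else 2*u - (2*h+1)) = (if v \<le> h then 2*v else 2*v - (2*h+1))"
    using assms by simp
  moreover have ne: "2*a \<noteq> 2*b - (2*h+1)" if "b > h" for a b
  proof -
    have "odd (2*b - (2*h+1))" using that by simp
    then show ?thesis by (metis dvd_triv_left)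
  qed
  ultimately show ?thesis by (cases "u \<le> h"; cases "v \<le> h") (use ne[of v u] ne[of u v] in auto)
qed

text \<open>If \<open>c\<close> numbers the elements of a set of odd size \<open>N\<close> by \<open>0, ..., N - 1\<close>, then the pairs with a
  given sum modulo \<open>N\<close> form a matching that misses exactly the element whose double has that sum. The
  matching is named after the element it misses.\<close>

definition near_factor :: "('v \<Rightarrow> nat) \<Rightarrow> 'v set \<Rightarrow> 'v \<Rightarrow> 'v set set" where
  "near_factor c L v = {e \<in> pairs L. (\<Sum>x\<in>e. c x) mod card L = (2 * c v) mod card L}"

lemma doubleton_in_near_factor:
  "u \<noteq> w \<Longrightarrow> {u, w} \<in> near_factor c L v \<longleftrightarrow>
    u \<in> L \<and> w \<in> L \<and> (c u + c w) mod card L = (2 * c v) mod card L"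
  by (auto simp: near_factor_def)

lemma near_factor_disjoint:
  assumes c: "bij_betw c L {..<card L}" and "odd (card L)" "u \<in> L" "v \<in> L" "u \<noteq> v"
  shows "near_factor c L u \<inter> near_factor c L v = {}"
proof -
  obtain h where h: "card L = 2*h+1" using assms(2) by (auto elim: oddE)
  have "c u < 2*h+1" "c v < 2*h+1" "c u \<noteq> c v"
    using assms h by (auto simp: bij_betw_def inj_on_def)
  then have "(2 * c u) mod card L \<noteq> (2 * c v) mod card L"
    using two_mod_odd_inj[of "c u" h "c v"] h by auto
  then show ?thesis by (auto simp: near_factor_def)
qed

lemma near_factor_covers:
  assumes c: "bij_betw c L {..<card L}" and "odd (card L)" "u \<in> L" "v \<in> L" "u \<noteq> v"
  shows "u \<in> \<Union>(near_factor c L v)"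
proof -
  obtain h where h: "card L = 2*h+1" using assms(2) by (auto elim: oddE)
  define j where "j = (2 * c v + card L - c u) mod card L"
  have lt: "c u < 2*h+1" "c v < 2*h+1" using assms h by (auto simp: bij_betw_def)
  have "j \<in> c ` L" using c h by (auto simp: bij_betw_def j_def)
  then obtain w where w: "w \<in> L" "c w = j" by auto
  have "(c u + j) mod card L = (c u + (2 * c v + card L - c u)) mod card L"
    unfolding j_def by (simp add: mod_simps)
  also have "c u + (2 * c v + card L - c u) = 2 * c v + card L" using lt h by simp
  also have "(2 * c v + card L) mod card L = (2 * c v) mod card L" by simp
  finally have sum: "(c u + c w) mod card L = (2 * c v) mod card L" using w by simp
  have "c u \<noteq> c v" using assms by (auto simp: bij_betw_def inj_on_def)
  then have "u \<noteq> w" using two_mod_odd_inj[of "c u" h "c v"] lt h sum by (auto simp: mult_2)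
  then have "{u, w} \<in> near_factor c L v"
    using sum w assms by (simp add: doubleton_in_near_factor)
  then show ?thesis by blast
qed

lemma near_factor_sub: "near_factor c L v \<subseteq> pairs L"
  by (auto simp: near_factor_def)

lemma ex_bij_finite_same_card:
  assumes "finite A" "finite B" "card A = card B"
  shows "\<exists>f. bij_betw f A B"
  using assms finite_same_card_bij by blast

text \<open>In these coordinates the matching missing \<open>z\<close> consists of the pairs \<open>{i, N - i}\<close>, hence it joins \<open>T\<close>
  to the other elements. This makes it possible to prescribe one end of each of its edges.\<close>

lemma ex_coordinates:
  assumes L: "finite L" "card L = 2*h+1" and z: "z \<in> L" and T: "T \<subseteq> L - {z}" "card T = h"
  obtains c where "bij_betw c L {..<card L}" "c z = 0" "c ` T = {1..h}"
proof -
  have finT: "finite T" using T L finite_subset by (metis finite_Diff)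
  obtain f where f: "bij_betw f T {1..h}"
    using ex_bij_finite_same_card[of T "{1..h}"] finT T by auto
  have "card (L - {z} - T) = h" using L z T finT by (simp add: card_Diff_subset)
  then obtain g where g: "bij_betw g (L - {z} - T) {h+1..2*h}"
    using ex_bij_finite_same_card[of "L - {z} - T" "{h+1..2*h}"] L by auto
  have "bij_betw (\<lambda>x. if x \<in> T then f x else g x) (T \<union> (L - {z} - T)) ({1..h} \<union> {h+1..2*h})"
    by (rule bij_betw_disjoint_Un[OF f g]) auto
  then have 1: "bij_betw (\<lambda>x. if x \<in> T then f x else g x) (L - {z}) {1..2*h}"
  proof -
    have "T \<union> (L - {z} - T) = L - {z}" "{1..h} \<union> {h+1..2*h} = {1..2*h}" using T by auto
    with \<open>bij_betw _ (T \<union> _) _\<close> show ?thesis by simp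
  qed
  define c where "c x = (if x \<in> {z} then 0 else if x \<in> T then f x else g x)" for x
  have "bij_betw c ({z} \<union> (L - {z})) ({0} \<union> {1..2*h})"
    unfolding c_def by (rule bij_betw_disjoint_Un[OF _ 1]) (auto simp: bij_betw_def)
  moreover have "{z} \<union> (L - {z}) = L" using z by auto
  moreover have "{0} \<union> {1..2*h} = {..<card L}" using L by auto
  ultimately have "bij_betw c L {..<card L}" by simp
  moreover have "c z = 0" by (simp add: c_def)
  moreover have "c ` T = f ` T" using T by (intro image_cong) (auto simp: c_def)
  then have "c ` T = {1..h}" using f by (simp add: bij_betw_def)
  ultimately show ?thesis using that by blast
qed

text \<open>Every matching is completed at the point it misses by an edge leaving the line.\<close>

lemma scheme_full:
  assumes L: "finite L" "odd (card L)" and w: "\<And>v. v \<in> L \<Longrightarrow> w v \<notin> L"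
  shows "scheme (pairs L \<union> {{v, w v} |v. v \<in> L}) (card L) {insert (w v) L |v. v \<in> L}
           (\<lambda>_. 0) (\<lambda>_. 0)"
proof -
  obtain c where c: "bij_betw c L {..<card L}"
    using ex_bij_betw_finite_nat[OF L(1)] by (auto simp: atLeast0LessThan)
  let ?C = "\<lambda>v. insert {v, w v} (near_factor c L v)"
  show ?thesis
  proof (rule schemeI[where J = L and C = ?C and K = "\<lambda>v. insert (w v) L" and G = "\<lambda>_. {}"])
    show "disjoint_family_on ?C L"
      unfolding disjoint_family_on_def
    proof (intro ballI impI)
      fix u v assume uv: "u \<in> L" "v \<in> L" "u \<noteq> v"
      have "{x, w x} \<notin> near_factor c L y" if "x \<in> L" for x y
        using near_factor_sub[of c L y] w[OF that] by (metis doubleton_in_pairs subsetD)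
      moreover have "{u, w u} \<noteq> {v, w v}" using uv w by (metis doubleton_eq_iff)
      ultimately show "?C u \<inter> ?C v = {}" using near_factor_disjoint[OF c L(2) uv] uv by auto
    qed
    fix v
    have "v \<in> \<Union>(?C j)" if "j \<in> L" "v \<in> insert (w j) L" for j
      using that near_factor_covers[OF c L(2), of v j] by (cases "v = j \<or> v = w j") auto
    then have "{j \<in> L. v \<in> insert (w j) L \<and> v \<notin> \<Union>(?C j)} = {}" by blast
    then show "card {j \<in> L. v \<in> insert (w j) L \<and> v \<notin> \<Union>(?C j)} \<le> 0" by (simp only: card.empty order_refl)
  qed (use L near_factor_sub[of c L] in \<open>auto simp: disjoint_family_on_def\<close>)
qed

text \<open>The interface to the matchings that is needed for loans: \<open>p\<close> exchanges the two ends of each edge of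
  the matching missing \<open>z\<close>, and each such edge has exactly one end in the prescribed half \<open>T\<close>.\<close>

lemma near_factorization_with_matching:
  assumes L: "finite L" "card L = 2*h+1" and z: "z \<in> L" and T: "T \<subseteq> L - {z}" "card T = h"
  obtains M p where "disjoint_family_on M L" "\<And>v. M v \<subseteq> pairs L"
    "\<And>u v. u \<in> L \<Longrightarrow> v \<in> L \<Longrightarrow> u \<noteq> v \<Longrightarrow> u \<in> \<Union>(M v)"
    "\<And>u. u \<in> L - {z} \<Longrightarrow> {u, p u} \<in> M z" "\<And>u. u \<in> L - {z} \<Longrightarrow> u \<in> T \<longleftrightarrow> p u \<notin> T"
proof -
  obtain c where c: "bij_betw c L {..<card L}" "c z = 0" "c ` T = {1..h}"
    by (rule ex_coordinates[OF assms])
  have odd: "odd (card L)" using L by simp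
  have inj: "u = v" if "u \<in> L" "v \<in> L" "c u = c v" for u v
    using c that by (auto simp: bij_betw_def inj_on_def)
  have ex: "\<exists>w\<in>L. c w = card L - c u" if "u \<in> L - {z}" for u
  proof -
    have "c u \<noteq> 0" using inj[of u z] that c(2) z by auto
    then have "card L - c u \<in> c ` L" using c L by (auto simp: bij_betw_def)
    then show ?thesis by auto
  qed
  define p where "p u = (SOME w. w \<in> L \<and> c w = card L - c u)" for u
  have p: "p u \<in> L" "c (p u) = card L - c u" if "u \<in> L - {z}" for u
    using someI_ex[of "\<lambda>w. w \<in> L \<and> c w = card L - c u"] ex[OF that] by (auto simp: p_def)
  have cT: "u \<in> T \<longleftrightarrow> c u \<in> {1..h}" if "u \<in> L" for u
  proof
    assume "c u \<in> {1..h}"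
    then obtain t where "t \<in> T" "c t = c u" using c(3) by (metis imageE)
    then show "u \<in> T" using inj[of t u] that T by auto
  qed (use c(3) in blast)
  have cpos: "0 < c u" "c u < 2*h+1" if "u \<in> L - {z}" for u
  proof -
    show "0 < c u" using inj[of u z] that c(2) z by auto
    show "c u < 2*h+1" using that c L by (auto simp: bij_betw_def)
  qed
  show ?thesis
  proof (rule that[of "near_factor c L" p])
    show "disjoint_family_on (near_factor c L) L"
      using near_factor_disjoint[OF c(1) odd] by (simp add: disjoint_family_on_def)
    fix u assume u: "u \<in> L - {z}"
    have "c (p u) \<noteq> c u" using p[OF u] cpos[OF u] L by presburger
    then have "u \<noteq> p u" by auto
    moreover have "c u + c (p u) = card L" using p[OF u] cpos[OF u] L by simp
    ultimately show "{u, p u} \<in> near_factor c L z"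
      using u p[OF u] c by (simp add: doubleton_in_near_factor)
    show "u \<in> T \<longleftrightarrow> p u \<notin> T" using cT[of u] cT[of "p u"] u p[OF u] cpos[OF u] L by auto
  qed (fact near_factor_sub near_factor_covers[OF c(1) odd])+
qed

text \<open>Only the matchings missing a point other than \<open>z\<close> are completed, by edges to a single vertex \<open>w\<close>.
  The matching missing \<open>z\<close> is left over, and each of its edges is lent at its end in \<open>T\<close>.\<close>

lemma scheme_lender:
  assumes L: "finite L" "card L = 2*h+1" and z: "z \<in> L" and T: "T \<subseteq> L - {z}" "card T = h"
    and w: "w \<notin> L"
  shows "scheme (pairs L \<union> {{v, w} |v. v \<in> L - {z}}) (2*h) {insert w L} (\<lambda>_. 0) (\<lambda>v. of_bool (v \<in> T))"
proof -
  obtain M p where M: "disjoint_family_on M L" "\<And>v. M v \<subseteq> pairs L"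
    "\<And>u v. u \<in> L \<Longrightarrow> v \<in> L \<Longrightarrow> u \<noteq> v \<Longrightarrow> u \<in> \<Union>(M v)"
    "\<And>u. u \<in> L - {z} \<Longrightarrow> {u, p u} \<in> M z" "\<And>u. u \<in> L - {z} \<Longrightarrow> u \<in> T \<longleftrightarrow> p u \<notin> T"
    by (rule near_factorization_with_matching[OF L z T]) blast
  let ?C = "\<lambda>v. insert {v, w} (M v)"
  let ?G = "\<lambda>v. if v \<in> T then {{v, p v}} else {}"
  have wM: "{x, w} \<notin> M y" for x y
    using M(2)[of y] w by (metis doubleton_in_pairs subsetD)
  have TM: "{x, p x} \<in> M z" if "x \<in> T" for x using M(4) T that by blast
  show ?thesis
  proof (rule schemeI[where J = "L - {z}" and C = ?C and K = "\<lambda>v. insert w L" and G = ?G])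
    show "disjoint_family_on ?C (L - {z})"
      unfolding disjoint_family_on_def
    proof (intro ballI impI)
      fix u v assume uv: "u \<in> L - {z}" "v \<in> L - {z}" "u \<noteq> v"
      moreover have "{u, w} \<noteq> {v, w}" using uv w by (metis doubleton_eq_iff)
      moreover have "M u \<inter> M v = {}" using M(1) uv by (simp add: disjoint_family_on_def)
      ultimately show "?C u \<inter> ?C v = {}" using wM by auto
    qed
    show "disjoint_family ?G"
      unfolding disjoint_family_on_def
    proof (intro ballI impI)
      fix u v :: 'a assume "u \<noteq> v"
      then have "{u, p u} \<noteq> {v, p v}" if "u \<in> T" "v \<in> T"
        using M(5) T that by (metis doubleton_eq_iff subsetD)
      then show "?G u \<inter> ?G v = {}" by auto
    qed
    show "?C j \<inter> ?G v = {}" if "j \<in> L - {z}" for j v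
    proof -
      have "M j \<inter> M z = {}" using M(1) that z by (simp add: disjoint_family_on_def)
      then show ?thesis using TM[of v] wM[of j z] by (cases "{j, w} = {v, p v}") auto
    qed
    show "?G v \<subseteq> pairs L \<union> {{v, w} |v. v \<in> L - {z}}" for v
      using subsetD[OF M(2) TM[of v]] by (cases "v \<in> T") (simp_all del: doubleton_in_pairs)
    fix v
    have "v \<in> \<Union>(?C j)" if "j \<in> L - {z}" "v \<in> insert w L" for j
      using that M(3)[of v j] by (cases "v = j \<or> v = w") auto
    then have "{j \<in> L - {z}. v \<in> insert w L \<and> v \<notin> \<Union>(?C j)} = {}" by blast
    then show "card {j \<in> L - {z}. v \<in> insert w L \<and> v \<notin> \<Union>(?C j)} \<le> 0" by (simp only: card.empty order_refl)
  qed (use L z M(2) in \<open>auto split: if_splits\<close>)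
qed

text \<open>The matching missing \<open>z\<close> is given up. Each of its \<open>h\<close> edges completes the matching missing its end
  outside \<open>T\<close>, and the matchings missing a point of \<open>T\<close> remain unfinished.\<close>

lemma scheme_borrower:
  assumes L: "finite L" "card L = 2*h+1" and z: "z \<in> L" and T: "T \<subseteq> L - {z}" "card T = h"
  shows "scheme (pairs L) (2*h) {L} (\<lambda>v. of_bool (v \<in> T)) (\<lambda>_. 0)"
proof -
  obtain M p where M: "disjoint_family_on M L" "\<And>v. M v \<subseteq> pairs L"
    "\<And>u v. u \<in> L \<Longrightarrow> v \<in> L \<Longrightarrow> u \<noteq> v \<Longrightarrow> u \<in> \<Union>(M v)"
    "\<And>u. u \<in> L - {z} \<Longrightarrow> {u, p u} \<in> M z" "\<And>u. u \<in> L - {z} \<Longrightarrow> u \<in> T \<longleftrightarrow> p u \<notin> T"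
    by (rule near_factorization_with_matching[OF L z T]) blast
  let ?C = "\<lambda>v. M v \<union> (if v \<in> T then {} else {{v, p v}})"
  have Md: "M u \<inter> M v = {}" if "u \<in> L" "v \<in> L" "u \<noteq> v" for u v
    using M(1) that by (simp add: disjoint_family_on_def)
  show ?thesis
  proof (rule schemeI[where J = "L - {z}" and C = ?C and K = "\<lambda>v. L" and G = "\<lambda>_. {}"])
    show "disjoint_family_on ?C (L - {z})"
      unfolding disjoint_family_on_def
    proof (intro ballI impI)
      fix u v assume uv: "u \<in> L - {z}" "v \<in> L - {z}" "u \<noteq> v"
      have "{u, p u} \<noteq> {v, p v}" if "u \<notin> T" "v \<notin> T"
        using M(5) uv that by (metis doubleton_eq_iff)
      moreover have "{u, p u} \<notin> M v" "{v, p v} \<notin> M u"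
        using M(4) uv z Md[of u z] Md[of v z] by blast+
      moreover have "M u \<inter> M v = {}" using Md uv by auto
      ultimately show "?C u \<inter> ?C v = {}" by auto
    qed
    show "?C j \<subseteq> pairs L" if "j \<in> L - {z}" for j
      using M(2)[of j] subsetD[OF M(2) M(4)[OF that]] by (simp del: doubleton_in_pairs)
    fix v
    have cov: "v \<in> \<Union>(?C j)" if "j \<in> L - {z}" "v \<in> L" "j \<noteq> v \<or> v \<notin> T" for j
      using that M(3)[of v j] by (cases "v = j") auto
    have "{j \<in> L - {z}. v \<in> L \<and> v \<notin> \<Union>(?C j)} \<subseteq> (if v \<in> T then {v} else {})"
    proof
      fix j assume "j \<in> {j \<in> L - {z}. v \<in> L \<and> v \<notin> \<Union>(?C j)}"
      then have "j \<in> L - {z}" "v \<in> L" "v \<notin> \<Union>(?C j)" by blast+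
      then have "j = v \<and> v \<in> T" using cov by blast
      then show "j \<in> (if v \<in> T then {v} else {})" by simp
    qed
    then have "card {j \<in> L - {z}. v \<in> L \<and> v \<notin> \<Union>(?C j)} \<le> card (if v \<in> T then {v} else {})"
      by (intro card_mono) auto
    also have "\<dots> = of_bool (v \<in> T)" by simp
    finally show "card {j \<in> L - {z}. v \<in> L \<and> v \<notin> \<Union>(?C j)} \<le> of_bool (v \<in> T)" .
  qed (use L z in \<open>auto simp: disjoint_family_on_def\<close>)
qed

text \<open>The matchings missing \<open>x\<close> and \<open>y\<close> are given up, where \<open>y\<close> has number \<open>h + 1\<close>. Together they form a
  path through all points with ends \<open>x\<close> and \<open>y\<close>: the pairs of sum \<open>0\<close> and of sum \<open>1\<close>. Each of the other
  \<open>2 * h - 1\<close> points receives a path edge of its own, and the edge from \<open>x\<close> to the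
  point with number \<open>1\<close> is spare.\<close>

lemma scheme_edge_covers:
  assumes L: "finite L" "card L = 2*h+1" and h: "h > 0" and x: "x \<in> L"
  shows "scheme (pairs L) (2*h - 1) {L} (\<lambda>_. 0) (\<lambda>v. of_bool (v = x))"
proof -
  have "h \<le> card (L - {x})" using L x by simp
  then obtain T where T: "T \<subseteq> L - {x}" "card T = h" by (metis obtain_subset_with_card_n)
  obtain c where c: "bij_betw c L {..<card L}" "c x = 0"
    by (rule ex_coordinates[OF L x T])
  have odd: "odd (card L)" using L by simp
  have inj: "u = v" if "u \<in> L" "v \<in> L" "c u = c v" for u v
    using c that by (auto simp: bij_betw_def inj_on_def)
  have lt: "c u < 2*h+1" if "u \<in> L" for u using that c L by (auto simp: bij_betw_def)
  define p where "p i = (SOME w. w \<in> L \<and> c w = i)" for i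
  have p: "p i \<in> L" "c (p i) = i" if "i < 2*h+1" for i
  proof -
    have "i \<in> c ` L" using that c L by (simp add: bij_betw_def)
    then have "\<exists>w. w \<in> L \<and> c w = i" by auto
    from someI_ex[OF this] show "p i \<in> L" "c (p i) = i" by (simp_all add: p_def)
  qed
  define y where "y = p (h+1)"
  have y: "y \<in> L" "c y = h+1" using p[of "h+1"] h by (auto simp: y_def)
  have xy: "x \<noteq> y" using c(2) y by auto
  \<comment> \<open>The other end of the path edge assigned to a point: sum 0 for small numbers, sum 1 for large ones.\<close>
  define r where "r v = p (if c v \<le> h then 2*h+1 - c v else 2*h+2 - c v)" for v
  define M where "M = near_factor c L"
  have Md: "M u \<inter> M v = {}" if "u \<in> L" "v \<in> L" "u \<noteq> v" for u v
    using near_factor_disjoint[OF c(1) odd that] by (simp add: M_def)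
  have pos: "0 < c v" "c v \<noteq> h+1" if "v \<in> L - {x, y}" for v
    using that inj[of v x] inj[of v y] c(2) y x by auto
  have r: "r v \<in> L" "c (r v) = (if c v \<le> h then 2*h+1 - c v else 2*h+2 - c v)"
    if "v \<in> L - {x, y}" for v
    using pos[OF that] lt[of v] that p[of "if c v \<le> h then 2*h+1 - c v else 2*h+2 - c v"]
    by (auto simp: r_def split: if_splits)
  have rM: "{v, r v} \<in> M (if c v \<le> h then x else y)" if v: "v \<in> L - {x, y}" for v
  proof (cases "c v \<le> h")
    case True
    then have "c (r v) \<noteq> c v" "c v + c (r v) = 2*h+1" using r(2)[OF v] by simp_all
    moreover from this have "v \<noteq> r v" by auto
    ultimately show ?thesis
      using True v r(1)[OF v] c(2) L by (auto simp: M_def doubleton_in_near_factor)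
  next
    case False
    then have "c (r v) \<noteq> c v" "c v + c (r v) = 2*h+2"
      using r(2)[OF v] pos[OF v] lt[of v] v by auto
    moreover from this have "v \<noteq> r v" by auto
    ultimately show ?thesis
      using False v r(1)[OF v] y L by (auto simp: M_def doubleton_in_near_factor)
  qed
  have rxy: "{v, r v} \<in> M x \<union> M y" if "v \<in> L - {x, y}" for v
    using rM[OF that] by (auto split: if_splits)
  have r_inj: "{u, r u} \<noteq> {v, r v}" if uv: "u \<in> L - {x, y}" "v \<in> L - {x, y}" "u \<noteq> v" for u v
  proof
    assume eq: "{u, r u} = {v, r v}"
    then have "(if c u \<le> h then x else y) = (if c v \<le> h then x else y)"
      using rM[OF uv(1)] rM[OF uv(2)] Md[OF x y(1) xy] by (auto split: if_splits)
    then have "c u \<le> h \<longleftrightarrow> c v \<le> h" using xy by (auto split: if_splits)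
    moreover have "c u = c (r v)" using eq uv by (metis doubleton_eq_iff)
    ultimately show False
      using r(2)[OF uv(2)] pos[OF uv(1)] pos[OF uv(2)] lt[of v] uv by (auto split: if_splits)
  qed
  define e where "e = {x, p 1}"
  have "p 1 \<in> L" "c (p 1) = 1" using p[of 1] h by auto
  moreover from this have "x \<noteq> p 1" using c(2) by auto
  ultimately have eM: "e \<in> M y"
    using x c(2) y L h by (simp add: e_def M_def doubleton_in_near_factor le_mod_geq)
  have e_new: "e \<noteq> {v, r v}" if "v \<in> L - {x, y}" for v
  proof
    assume eq: "e = {v, r v}"
    then have "e \<in> M (if c v \<le> h then x else y)" using rM[OF that] by simp
    then have "\<not> c v \<le> h" using eM Md[OF x y(1) xy] by (auto split: if_splits)
    moreover have "v = p 1" using eq that by (auto simp: e_def doubleton_eq_iff)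
    ultimately show False using \<open>c (p 1) = 1\<close> h by auto
  qed
  let ?C = "\<lambda>v. insert {v, r v} (M v)"
  show ?thesis
  proof (rule schemeI[where J = "L - {x, y}" and C = ?C and K = "\<lambda>v. L"
        and G = "\<lambda>v. if v = x then {e} else {}"])
    show "disjoint_family_on ?C (L - {x, y})"
      unfolding disjoint_family_on_def
    proof (intro ballI impI)
      fix u v assume uv: "u \<in> L - {x, y}" "v \<in> L - {x, y}" "u \<noteq> v"
      have "{u, r u} \<notin> M v" "{v, r v} \<notin> M u"
        using rxy[OF uv(1)] rxy[OF uv(2)] Md[of u x] Md[of u y] Md[of v x] Md[of v y] uv x y by auto
      then show "?C u \<inter> ?C v = {}" using Md[of u v] r_inj[OF uv] uv by auto
    qed
    show "?C j \<subseteq> pairs L" if "j \<in> L - {x, y}" for j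
    proof -
      have "{j, r j} \<in> pairs L"
        using rxy[OF that] near_factor_sub[of c L x] near_factor_sub[of c L y] unfolding M_def by blast
      then show ?thesis
        using near_factor_sub[of c L j] by (simp add: M_def del: doubleton_in_pairs)
    qed
    show "?C j \<inter> (if v = x then {e} else {}) = {}" if "j \<in> L - {x, y}" for j v
      using e_new[OF that] eM Md[of j y] that y by auto
    show "(if v = x then {e} else {}) \<subseteq> pairs L" for v
      using eM near_factor_sub[of c L y] by (auto simp: M_def)
    show "card (L - {x, y}) = 2 * h - 1" using L x y xy by simp
    fix v
    have "v \<in> \<Union>(?C j)" if "j \<in> L - {x, y}" "v \<in> L" for j
      using that near_factor_covers[OF c(1) odd, folded M_def, of v j] by (cases "v = j") auto
    then have "{j \<in> L - {x, y}. v \<in> L \<and> v \<notin> \<Union>(?C j)} = {}" by blast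
    then show "card {j \<in> L - {x, y}. v \<in> L \<and> v \<notin> \<Union>(?C j)} \<le> 0" by (simp only: card.empty order_refl)
  qed (use L in \<open>auto simp: disjoint_family_on_def e_def split: if_splits\<close>)
qed

section \<open>Edge covers with one exceptional vertex\<close>

text \<open>An edge colouring of the complete graph on \<open>0, ..., 2 * h\<close> with \<open>2 * h\<close> colours in which every vertex
  except the centre \<open>2 * h\<close> sees each colour exactly once. It starts from the one-factorization of the
  complete graph on the other vertices given by sums modulo \<open>2 * h - 1\<close>, with \<open>2 * h - 1\<close> as the
  vertex at infinity. The edges \<open>{2 * t, 2 * t + 1}\<close> with \<open>t < h - 1\<close> are disjoint and of different
  colours, because their sums \<open>4 * t + 1\<close> are different modulo \<open>2 * h - 1\<close>. They are recoloured with
  the new colour \<open>2 * h - 1\<close>, and the two edges from their ends to the centre take over the old one. In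
  the new colour only \<open>2 * h - 2\<close> and \<open>2 * h - 1\<close> are still uncovered, and they are joined to the centre
  as well.\<close>

definition rainbow_colour :: "nat \<Rightarrow> nat \<Rightarrow> nat \<Rightarrow> nat" where
  "rainbow_colour h i j =
    (if j = 2*h then (if i div 2 = h - 1 then 2*h - 1 else (4 * (i div 2) + 1) mod (2*h - 1))
     else if even i \<and> j = Suc i \<and> i < 2*h - 2 then 2*h - 1
     else if j = 2*h - 1 then (2*i) mod (2*h - 1)
     else (i + j) mod (2*h - 1))"

lemma rainbow_colour_covers:
  assumes h: "h > 0" and i: "i < 2*h" and k: "k < 2*h"
  shows "\<exists>j\<le>2*h. j \<noteq> i \<and> rainbow_colour h (min i j) (max i j) = k"
proof -
  define Q where "Q = 2*h - 1"
  have Q: "Q > 0" "2*h = Suc Q" using h by (auto simp: Q_def)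
  show ?thesis
  proof (cases "k = Q")
    case True
    show ?thesis
    proof (cases "i < 2*h - 2")
      case True
      show ?thesis
      proof (cases "even i")
        case True
        then show ?thesis using \<open>i < 2*h - 2\<close> \<open>k = Q\<close> Q
          by (intro exI[of _ "Suc i"]) (auto simp: rainbow_colour_def)
      next
        case False
        then obtain t where "i = 2*t + 1" by (auto elim: oddE)
        then show ?thesis using \<open>i < 2*h - 2\<close> \<open>k = Q\<close> Q
          by (intro exI[of _ "2*t"]) (auto simp: rainbow_colour_def min_def max_def)
      qed
    next
      case False
      then have "i div 2 = h - 1" using i by auto
      then show ?thesis using \<open>k = Q\<close> i Q
        by (intro exI[of _ "2*h"]) (auto simp: rainbow_colour_def min_def max_def)
    qed
  next
    case False
    then have k: "k < Q" using k Q by auto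
    show ?thesis
    proof (cases "i < Q")
      case True
      define j where "j = (k + Q - i) mod Q"
      have j: "j < Q" using Q by (simp add: j_def)
      have "(i + j) mod Q = (i + (k + Q - i)) mod Q" unfolding j_def by (simp add: mod_simps)
      also have "i + (k + Q - i) = k + Q" using True by simp
      finally have sum: "(i + j) mod Q = k" using k by simp
      consider "j = i"
        | "j \<noteq> i" "even (min i j)" "max i j = Suc (min i j)" "min i j < 2*h - 2"
        | "j \<noteq> i" "\<not> (even (min i j) \<and> max i j = Suc (min i j) \<and> min i j < 2*h - 2)"
        by blast
      then show ?thesis
      proof cases
        case 1
        then have "(2*i) mod Q = k" using sum by (simp add: mult_2)
        then show ?thesis using True Q
          by (intro exI[of _ Q]) (auto simp: rainbow_colour_def Q_def[symmetric] min_def max_def)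
      next
        \<comment> \<open>The partner of sum k has been recoloured, so the centre replaces it.\<close>
        case 2
        have "i div 2 = min i j div 2" "i + j = 4 * (min i j div 2) + 1"
          using 2 by (auto simp: min_def max_def split: if_splits elim!: evenE)
        moreover have "min i j div 2 \<noteq> h - 1" using 2(4) by linarith
        ultimately have "rainbow_colour h i (2*h) = k"
          using sum by (simp add: rainbow_colour_def Q_def)
        then show ?thesis using i by (intro exI[of _ "2*h"]) (auto simp: min_def max_def)
      next
        case 3
        have "max i j < Q" using True j by simp
        then have ne: "max i j \<noteq> 2*h" "max i j \<noteq> 2*h - 1" using Q by auto
        have "rainbow_colour h (min i j) (max i j) = (min i j + max i j) mod Q"
          by (simp only: rainbow_colour_def ne 3(2) if_False Q_def)
        also have "min i j + max i j = i + j" by (simp add: min_def max_def)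
        finally show ?thesis using sum j 3 Q by (intro exI[of _ j]) auto
      qed
    next
      case False
      then have iQ: "i = Q" using i Q by simp
      define j where "j = (k * h) mod Q"
      have j: "j < Q" using Q by (simp add: j_def)
      have "(2 * j) mod Q = (k * (2 * h)) mod Q" unfolding j_def by (simp add: mod_simps ac_simps)
      also have "k * (2 * h) = k * Q + k" using Q by simp
      finally have "(2 * j) mod Q = k" using k by simp
      then show ?thesis using j iQ Q
        by (intro exI[of _ j]) (auto simp: rainbow_colour_def Q_def[symmetric] min_def max_def)
    qed
  qed
qed

text \<open>The centre sees \<open>h\<close> colours, each on its edges to \<open>2 * t\<close> and \<open>2 * t + 1\<close> for one \<open>t\<close>. It still sees
  them if its edges to even numbers are deleted.\<close>

lemma rainbow_colour_centre:
  assumes h: "h > 0"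
  obtains \<kappa> where "inj_on \<kappa> {..<h}" "\<And>t. t < h \<Longrightarrow> \<kappa> t < 2*h"
    "\<And>t. t < h \<Longrightarrow> rainbow_colour h (2*t+1) (2*h) = \<kappa> t"
proof
  let ?\<kappa> = "\<lambda>t. rainbow_colour h (2*t+1) (2*h)"
  have lt: "(4*t+1) mod (2*h-1) < 2*h - 1" for t using h by simp
  have eq: "?\<kappa> t = (if t = h - 1 then 2*h - 1 else (4*t+1) mod (2*h-1))" for t
    by (simp add: rainbow_colour_def)
  have "s = t" if "s \<le> t" "t < h - 1" "(4*s+1) mod (2*h-1) = (4*t+1) mod (2*h-1)" for s t
  proof -
    have "2*h - 1 dvd 4*t + 1 - (4*s+1)"
      using that by (subst mod_eq_dvd_iff_nat[symmetric]) auto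
    also have "4*t + 1 - (4*s+1) = 4 * (t - s)" using that by simp
    finally have "2*h - 1 dvd 4 * (t - s)" .
    moreover have "odd (2*h - 1)" using h by simp
    then have "coprime (2*h-1) (2^2)" by (metis coprime_power_right_iff coprime_right_2_iff_odd)
    then have "coprime (2*h-1) 4" by simp
    ultimately have "2*h - 1 dvd t - s" by (simp add: coprime_dvd_mult_right_iff)
    then show ?thesis using that by (auto dest: dvd_imp_le)
  qed
  then have inj: "s = t" if "s < h - 1" "t < h - 1" "(4*s+1) mod (2*h-1) = (4*t+1) mod (2*h-1)" for s t
    using that by (cases "s \<le> t") (metis nat_le_linear)+
  show "inj_on ?\<kappa> {..<h}"
  proof (rule inj_onI)
    fix s t assume st: "s \<in> {..<h}" "t \<in> {..<h}" "?\<kappa> s = ?\<kappa> t"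
    show "s = t"
    proof (cases "s = h - 1 \<or> t = h - 1")
      case True
      then show ?thesis using st(3) lt[of s] lt[of t] unfolding eq by (metis less_irrefl)
    next
      case False
      then have "s < h - 1" "t < h - 1" using st by auto
      moreover have "(4*s+1) mod (2*h-1) = (4*t+1) mod (2*h-1)" using st(3) False unfolding eq by simp
      ultimately show ?thesis by (rule inj)
    qed
  qed
  show "?\<kappa> t < 2*h" for t
  proof (cases "t = h - 1")
    case False
    then show ?thesis using less_trans[OF lt[of t], of "2*h"] h unfolding eq by simp
  qed (use h eq in simp)
qed simp

text \<open>Deleting the edges in \<open>Z\<close> costs a vertex other than the centre at most one colour per deleted edge.
  For the centre there is no additional loss: the at most \<open>h\<close> vertices to which it loses its edge can
  be given even numbers.\<close>

lemma scheme_centred: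
  assumes U: "finite U" "card U = 2*h+1" and h: "h > 0" and x0: "x0 \<in> U"
    and Z: "Z \<subseteq> pairs U" and R: "card {v \<in> U. {x0, v} \<in> Z} \<le> h"
  shows "scheme (pairs U - Z) (2*h) {U} (\<lambda>v. if v = x0 then h else card {e \<in> Z. v \<in> e}) (\<lambda>_. 0)"
proof -
  let ?V = "U - {x0}"
  have V: "finite ?V" "card ?V = 2*h" using U x0 by auto
  have "{x0, v} \<notin> Z" if "v = x0" for v
    using Z that by (metis doubleton_in_pairs subsetD)
  then have RV: "{v \<in> U. {x0, v} \<in> Z} \<subseteq> ?V" by blast
  obtain R' where R': "{v \<in> U. {x0, v} \<in> Z} \<subseteq> R'" "R' \<subseteq> ?V" "card R' = h"
    using exists_subset_between[OF R _ RV V(1)] V by auto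
  have evens: "card {i. i < 2*h \<and> even i} = h"
  proof -
    have "{i. i < 2*h \<and> even i} = (*) 2 ` {..<h}" by (auto elim!: evenE)
    then show ?thesis by (simp add: card_image inj_on_def)
  qed
  moreover have "{i. i < 2*h \<and> odd i} = {..<2*h} - {i. i < 2*h \<and> even i}" by auto
  ultimately have odds: "card {i. i < 2*h \<and> odd i} = h"
    by (simp add: card_Diff_subset subset_iff)
  have finR': "finite R'" using R' V finite_subset by blast
  obtain f where f: "bij_betw f R' {i. i < 2*h \<and> even i}"
    using ex_bij_finite_same_card[of R' "{i. i < 2*h \<and> even i}"] finR' R' evens by auto
  have "card (?V - R') = h" using V R' finR' by (simp add: card_Diff_subset)
  then obtain g where g: "bij_betw g (?V - R') {i. i < 2*h \<and> odd i}"
    using ex_bij_finite_same_card[of "?V - R'" "{i. i < 2*h \<and> odd i}"] V odds by auto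
  define c where "c v = (if v = x0 then 2*h else if v \<in> R' then f v else g v)" for v
  have cf: "c v < 2*h \<and> even (c v)" if "v \<in> R'" for v
    using that f R' by (auto simp: c_def bij_betw_def)
  have cg: "c v < 2*h \<and> odd (c v)" if "v \<in> ?V - R'" for v
    using that g by (auto simp: c_def bij_betw_def)
  have cx0: "c x0 = 2*h" by (simp add: c_def)
  have cV: "c v < 2*h" if "v \<in> U" "v \<noteq> x0" for v
    using that cf[of v] cg[of v] by blast
  have c_surj: "\<exists>v\<in>U. c v = i" if i: "i \<le> 2*h" for i
  proof -
    consider "i = 2*h" | "i < 2*h" "even i" | "i < 2*h" "odd i" using i by force
    then show ?thesis
    proof cases
      case 1 then show ?thesis using x0 cx0 by auto
    next
      case 2
      then obtain v where "v \<in> R'" "f v = i" using f by (metis (mono_tags, lifting) bij_betw_def imageE mem_Collect_eq)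
      then show ?thesis using R' by (intro bexI[of _ v]) (auto simp: c_def)
    next
      case 3
      then obtain v where "v \<in> ?V - R'" "g v = i" using g by (metis (mono_tags, lifting) bij_betw_def imageE mem_Collect_eq)
      then show ?thesis by (intro bexI[of _ v]) (auto simp: c_def)
    qed
  qed
  define col where "col e = rainbow_colour h (Min (c ` e)) (Max (c ` e))" for e
  have col: "col {u, v} = rainbow_colour h (min (c u) (c v)) (max (c u) (c v))" for u v
    by (simp add: col_def)
  have covered: "\<exists>w\<in>U. w \<noteq> v \<and> col {v, w} = k" if vk: "v \<in> U" "v \<noteq> x0" "k < 2*h" for v k
  proof -
    obtain j where j: "j \<le> 2*h" "j \<noteq> c v" "rainbow_colour h (min (c v) j) (max (c v) j) = k"
      using rainbow_colour_covers[OF h cV[OF vk(1,2)] vk(3)] by blast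
    obtain w where "w \<in> U" "c w = j" using c_surj[OF j(1)] by blast
    then show ?thesis using j by (intro bexI[of _ w]) (auto simp: col)
  qed
  let ?C = "\<lambda>k. {e \<in> pairs U. col e = k} - Z"
  show ?thesis
  proof (rule schemeI[where J = "{..<2*h}" and C = ?C and K = "\<lambda>_. U" and G = "\<lambda>_. {}"])
    fix v
    show "card {j \<in> {..<2*h}. v \<in> U \<and> v \<notin> \<Union>(?C j)} \<le> (if v = x0 then h else card {e \<in> Z. v \<in> e})"
    proof (cases "v = x0")
      case True
      obtain \<kappa> where \<kappa>: "inj_on \<kappa> {..<h}" "\<And>t. t < h \<Longrightarrow> \<kappa> t < 2*h"
        "\<And>t. t < h \<Longrightarrow> rainbow_colour h (2*t+1) (2*h) = \<kappa> t"
        using rainbow_colour_centre[OF h] by blast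
      have "x0 \<in> \<Union>(?C (\<kappa> t))" if t: "t < h" for t
      proof -
        obtain w where w: "w \<in> U" "c w = 2*t+1" using c_surj[of "2*t+1"] t by auto
        have "w \<noteq> x0" using w cx0 t by auto
        moreover have "w \<notin> R'" using cf[of w] w by auto
        then have "{x0, w} \<notin> Z" using R' w by blast
        moreover have "col {x0, w} = \<kappa> t" using \<kappa>(3)[OF t] t w cx0 by (simp add: col min_def max_def)
        ultimately show ?thesis using w x0 by (intro UnionI[of "{x0, w}"]) auto
      qed
      then have "{j \<in> {..<2*h}. v \<in> U \<and> v \<notin> \<Union>(?C j)} \<subseteq> {..<2*h} - \<kappa> ` {..<h}"
        using True by blast
      then have "card {j \<in> {..<2*h}. v \<in> U \<and> v \<notin> \<Union>(?C j)} \<le> card ({..<2*h} - \<kappa> ` {..<h})"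
        by (intro card_mono) auto
      also have "\<dots> = card {..<2*h} - card (\<kappa> ` {..<h})"
        using \<kappa>(2) by (intro card_Diff_subset) auto
      also have "\<dots> = h" using \<kappa>(1) by (simp add: card_image)
      finally show ?thesis using True by simp
    next
      case False
      have "\<exists>e\<in>Z. v \<in> e \<and> col e = k" if k: "k < 2*h" "v \<in> U" "v \<notin> \<Union>(?C k)" for k
      proof -
        obtain w where w: "w \<in> U" "w \<noteq> v" "col {v, w} = k" using covered[OF k(2) False k(1)] by blast
        then have "{v, w} \<in> {e \<in> pairs U. col e = k}" using k by simp
        then have "{v, w} \<in> Z" using k(3) by blast
        then show ?thesis using w by blast
      qed
      then have sub: "{j \<in> {..<2*h}. v \<in> U \<and> v \<notin> \<Union>(?C j)} \<subseteq> col ` {e \<in> Z. v \<in> e}"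
        by blast
      have "finite {e \<in> Z. v \<in> e}"
        using Z finite_pairs[OF U(1)] by (auto intro: finite_subset)
      then have "card {j \<in> {..<2*h}. v \<in> U \<and> v \<notin> \<Union>(?C j)} \<le> card {e \<in> Z. v \<in> e}"
        by (rule surj_card_le[OF _ sub])
      then show ?thesis using False by simp
    qed
  qed (auto simp: disjoint_family_on_def)
qed

section \<open>Projective planes as families of point sets\<close>

text \<open>Number both sets by residues modulo \<open>r\<close>, and let two elements be related if their sum is less than
  \<open>h\<close> modulo \<open>r\<close>.\<close>

lemma ex_biregular_relation:
  assumes A: "finite A" "card A = r" and B: "finite B" "card B = r" and h: "h \<le> r"
  obtains \<rho> where "\<And>x. x \<in> A \<Longrightarrow> card {y \<in> B. \<rho> x y} = h"
    "\<And>y. y \<in> B \<Longrightarrow> card {x \<in> A. \<rho> x y} = h"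
proof -
  obtain f where f: "bij_betw f A {..<r}"
    using ex_bij_finite_same_card[of A "{..<r}"] A by auto
  obtain g where g: "bij_betw g B {..<r}"
    using ex_bij_finite_same_card[of B "{..<r}"] B by auto
  have count: "card {x \<in> C. (u x + j) mod r < h} = h" if u: "bij_betw u C {..<r}" for u :: "'c \<Rightarrow> nat" and C j
  proof -
    have "bij_betw (\<lambda>i. (i + j) mod r) {..<r} {..<r}"
    proof -
      have le: "x = x'" if "x \<le> x'" "x' < r" "(x + j) mod r = (x' + j) mod r" for x x'
      proof -
        have "r dvd (x' + j) - (x + j)"
          using that by (subst mod_eq_dvd_iff_nat[symmetric]) auto
        then have "r dvd x' - x" by simp
        then show ?thesis using that by (auto dest: dvd_imp_le)
      qed
      have "inj_on (\<lambda>i. (i + j) mod r) {..<r}"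
      proof (rule inj_onI)
        fix x x' assume "x \<in> {..<r}" "x' \<in> {..<r}" "(x + j) mod r = (x' + j) mod r"
        then show "x = x'" using le[of x x'] le[of x' x] by (cases "x \<le> x'") auto
      qed
      moreover have "(\<lambda>i. (i + j) mod r) ` {..<r} \<subseteq> {..<r}" by auto
      ultimately show ?thesis by (simp add: bij_betw_def endo_inj_surj)
    qed
    then have "bij_betw (\<lambda>x. (u x + j) mod r) C {..<r}"
      using u bij_betw_trans[of u C "{..<r}" "\<lambda>i. (i + j) mod r"] by (simp add: comp_def)
    then have inj: "inj_on (\<lambda>x. (u x + j) mod r) C"
      and onto: "(\<lambda>x. (u x + j) mod r) ` C = {..<r}" by (auto simp: bij_betw_def)
    have "{..<h} \<subseteq> (\<lambda>x. (u x + j) mod r) ` {x \<in> C. (u x + j) mod r < h}"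
    proof
      fix i assume "i \<in> {..<h}"
      moreover from this have "i \<in> (\<lambda>x. (u x + j) mod r) ` C" using h onto by auto
      ultimately show "i \<in> (\<lambda>x. (u x + j) mod r) ` {x \<in> C. (u x + j) mod r < h}" by auto
    qed
    then have "bij_betw (\<lambda>x. (u x + j) mod r) {x \<in> C. (u x + j) mod r < h} {..<h}"
      using inj by (intro bij_betw_imageI) (auto intro: inj_on_subset)
    then show ?thesis by (auto dest: bij_betw_same_card)
  qed
  show ?thesis
  proof (rule that[of "\<lambda>x y. (g y + f x) mod r < h"])
    show "card {y \<in> B. (g y + f x) mod r < h} = h" for x using count[OF g] .
    show "card {x \<in> A. (g y + f x) mod r < h} = h" for y
      using count[OF f, of "g y"] by (simp add: add.commute)
  qed
qed

locale plane_blocks =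
  fixes P :: "'v set" and \<L> :: "'v set set" and q :: nat
  assumes finite_points: "finite P"
    and line_sub: "l \<in> \<L> \<Longrightarrow> l \<subseteq> P"
    and card_line: "l \<in> \<L> \<Longrightarrow> card l = q + 1"
    and join: "x \<in> P \<Longrightarrow> y \<in> P \<Longrightarrow> x \<noteq> y \<Longrightarrow> \<exists>l\<in>\<L>. x \<in> l \<and> y \<in> l"
    and meet: "l \<in> \<L> \<Longrightarrow> k \<in> \<L> \<Longrightarrow> l \<noteq> k \<Longrightarrow> \<exists>!x. x \<in> l \<and> x \<in> k"
    and card_through: "x \<in> P \<Longrightarrow> card {l \<in> \<L>. x \<in> l} = q + 1"
    and card_lines: "card \<L> = q\<^sup>2 + q + 1"
begin

lemma finite_line: "l \<in> \<L> \<Longrightarrow> finite l"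
  using line_sub finite_points finite_subset by blast

lemma finite_lines: "finite \<L>"
  using card_lines by (intro card_ge_0_finite) simp

lemma line_eqI:
  "l \<in> \<L> \<Longrightarrow> k \<in> \<L> \<Longrightarrow> x \<in> l \<Longrightarrow> x \<in> k \<Longrightarrow> y \<in> l \<Longrightarrow> y \<in> k \<Longrightarrow> x \<noteq> y \<Longrightarrow> l = k"
  using meet by blast

lemma lines_meet: "l \<in> \<L> \<Longrightarrow> k \<in> \<L> \<Longrightarrow> l \<inter> k \<noteq> {}"
  using meet[of l k] card_line[of l] by (cases "l = k") auto

lemma pairs_lines_disjoint:
  assumes "l \<in> \<L>" "k \<in> \<L>" "l \<noteq> k"
  shows "pairs l \<inter> pairs k = {}"
proof -
  have False if e: "e \<in> pairs l" "e \<in> pairs k" for e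
  proof -
    obtain u v where "e = {u, v}" "u \<in> l" "v \<in> l" "u \<noteq> v" using e(1) by (rule pairsE)
    then show False using e(2) assms line_eqI[of l k u v] by auto
  qed
  then show ?thesis by blast
qed

definition pt :: "'v set \<Rightarrow> 'v set \<Rightarrow> 'v" where
  "pt k l = (THE x. x \<in> k \<and> x \<in> l)"

lemma pt_in:
  assumes "k \<in> \<L>" "l \<in> \<L>" "k \<noteq> l"
  shows "pt k l \<in> k" "pt k l \<in> l"
  using theI'[OF meet[OF assms]] by (auto simp: pt_def)

lemma pt_eq:
  assumes "k \<in> \<L>" "l \<in> \<L>" "k \<noteq> l" "x \<in> k" "x \<in> l"
  shows "pt k l = x"
  using meet[OF assms(1-3)] pt_in[OF assms(1-3)] assms(4,5) by blast

end

text \<open>Two lines through \<open>x0\<close> serve as coordinate axes: a line avoiding \<open>x0\<close> is determined by its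
  intersections \<open>z\<close> and \<open>y\<close> with them, which can be any points other than \<open>x0\<close>.\<close>

locale framed_plane = plane_blocks P \<L> q for P :: "'v set" and \<L> q +
  fixes l0 m0 :: "'v set" and x0 :: 'v
  assumes l0: "l0 \<in> \<L>" and m0: "m0 \<in> \<L>" and l0_m0: "l0 \<noteq> m0"
    and x0_l0: "x0 \<in> l0" and x0_m0: "x0 \<in> m0"
begin

definition N :: "'v set set" where "N = {l \<in> \<L>. x0 \<notin> l}"
abbreviation z :: "'v set \<Rightarrow> 'v" where "z \<equiv> pt l0"
abbreviation y :: "'v set \<Rightarrow> 'v" where "y \<equiv> pt m0"
abbreviation A :: "'v set" where "A \<equiv> l0 - {x0}"
abbreviation B :: "'v set" where "B \<equiv> m0 - {x0}"

lemma card_A: "card A = q" and card_B: "card B = q"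
  using card_line l0 m0 x0_l0 x0_m0 finite_line by auto

lemma finite_A: "finite A" and finite_B: "finite B"
  using l0 m0 finite_line by auto

lemma x0_P: "x0 \<in> P"
  using x0_l0 l0 line_sub by blast

lemma only_x0: "x \<in> l0 \<Longrightarrow> x \<in> m0 \<Longrightarrow> x = x0"
  using line_eqI[OF l0 m0 x0_l0 x0_m0, of x] l0_m0 by blast

lemma N_D:
  assumes "l \<in> N"
  shows "l \<in> \<L>" "l \<noteq> l0" "l \<noteq> m0" "x0 \<notin> l" "z l \<in> A" "z l \<in> l" "y l \<in> B" "y l \<in> l" "z l \<noteq> y l"
proof -
  show l: "l \<in> \<L>" "l \<noteq> l0" "l \<noteq> m0" "x0 \<notin> l" using assms x0_l0 x0_m0 by (auto simp: N_def)
  show z: "z l \<in> A" "z l \<in> l" using pt_in[OF l0 l(1)] l by auto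
  show y: "y l \<in> B" "y l \<in> l" using pt_in[OF m0 l(1)] l by auto
  show "z l \<noteq> y l" using y z only_x0[of "z l"] by auto
qed

lemma z_eq: "l \<in> N \<Longrightarrow> v \<in> l \<Longrightarrow> v \<in> l0 \<Longrightarrow> v = z l"
  using pt_eq[OF l0, of l v] N_D(1,2)[of l] by simp

lemma y_eq: "l \<in> N \<Longrightarrow> v \<in> l \<Longrightarrow> v \<in> m0 \<Longrightarrow> v = y l"
  using pt_eq[OF m0, of l v] N_D(1,3)[of l] by simp

lemma N_eqI: "l \<in> N \<Longrightarrow> k \<in> N \<Longrightarrow> z l = z k \<Longrightarrow> y l = y k \<Longrightarrow> l = k"
  using line_eqI[of l k "z l" "y l"] N_D[of l] N_D[of k] by simp

lemma N_ex:
  assumes "u \<in> A" "v \<in> B"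
  shows "\<exists>l\<in>N. z l = u \<and> y l = v"
proof -
  have "u \<noteq> v" using assms only_x0[of u] by auto
  moreover have "u \<in> P" "v \<in> P" using assms line_sub[OF l0] line_sub[OF m0] by auto
  ultimately obtain l where l: "l \<in> \<L>" "u \<in> l" "v \<in> l" using join[of u v] by blast
  have "x0 \<notin> l"
  proof
    assume "x0 \<in> l"
    then have "l = l0" "l = m0"
      using line_eqI[of l l0 x0 u] line_eqI[of l m0 x0 v] l l0 m0 x0_l0 x0_m0 assms by auto
    then show False using l0_m0 by simp
  qed
  then have "l \<in> N" using l by (simp add: N_def)
  then show ?thesis using z_eq[of l u] y_eq[of l v] l assms by (intro bexI[of _ l]) auto
qed

lemma N_bij: "bij_betw (\<lambda>l. (z l, y l)) N (A \<times> B)"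
proof (rule bij_betw_imageI)
  show "inj_on (\<lambda>l. (z l, y l)) N" using N_eqI by (auto intro: inj_onI)
  show "(\<lambda>l. (z l, y l)) ` N = A \<times> B"
  proof
    show "(\<lambda>l. (z l, y l)) ` N \<subseteq> A \<times> B"
    proof
      fix p assume "p \<in> (\<lambda>l. (z l, y l)) ` N"
      then obtain l where "l \<in> N" "p = (z l, y l)" by blast
      then show "p \<in> A \<times> B" using N_D(5,7)[of l] by simp
    qed
    show "A \<times> B \<subseteq> (\<lambda>l. (z l, y l)) ` N"
    proof
      fix p assume "p \<in> A \<times> B"
      then obtain u v where "p = (u, v)" "u \<in> A" "v \<in> B" by blast
      moreover from this obtain l where "l \<in> N" "z l = u" "y l = v" using N_ex[of u v] by blast
      ultimately show "p \<in> (\<lambda>l. (z l, y l)) ` N" by (intro image_eqI[of _ _ l]) auto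
    qed
  qed
qed

lemma card_N_y:
  assumes u: "u \<in> A" "Q \<subseteq> B"
  shows "card {l \<in> N. z l = u \<and> y l \<in> Q} = card Q"
proof -
  have "bij_betw y {l \<in> N. z l = u \<and> y l \<in> Q} Q"
  proof (rule bij_betw_imageI)
    show "inj_on y {l \<in> N. z l = u \<and> y l \<in> Q}"
    proof (rule inj_onI)
      fix j k assume "j \<in> {l \<in> N. z l = u \<and> y l \<in> Q}" "k \<in> {l \<in> N. z l = u \<and> y l \<in> Q}" "y j = y k"
      then show "j = k" by (intro N_eqI) auto
    qed
    show "y ` {l \<in> N. z l = u \<and> y l \<in> Q} = Q"
    proof
      show "Q \<subseteq> y ` {l \<in> N. z l = u \<and> y l \<in> Q}"
      proof
        fix v assume v: "v \<in> Q"
        then obtain l where "l \<in> N" "z l = u" "y l = v" using N_ex[of u v] u by blast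
        then show "v \<in> y ` {l \<in> N. z l = u \<and> y l \<in> Q}" using v by (intro image_eqI[of _ _ l]) auto
      qed
    qed auto
  qed
  then show ?thesis by (rule bij_betw_same_card)
qed

lemma card_N_z:
  assumes u: "v \<in> B" "Q \<subseteq> A"
  shows "card {l \<in> N. y l = v \<and> z l \<in> Q} = card Q"
proof -
  have "bij_betw z {l \<in> N. y l = v \<and> z l \<in> Q} Q"
  proof (rule bij_betw_imageI)
    show "inj_on z {l \<in> N. y l = v \<and> z l \<in> Q}"
    proof (rule inj_onI)
      fix j k assume "j \<in> {l \<in> N. y l = v \<and> z l \<in> Q}" "k \<in> {l \<in> N. y l = v \<and> z l \<in> Q}" "z j = z k"
      then show "j = k" by (intro N_eqI) auto
    qed
    show "z ` {l \<in> N. y l = v \<and> z l \<in> Q} = Q"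
    proof
      show "Q \<subseteq> z ` {l \<in> N. y l = v \<and> z l \<in> Q}"
      proof
        fix u assume u': "u \<in> Q"
        then obtain l where "l \<in> N" "z l = u" "y l = v" using N_ex[of u v] u by blast
        then show "u \<in> z ` {l \<in> N. y l = v \<and> z l \<in> Q}" using u' by (intro image_eqI[of _ _ l]) auto
      qed
    qed auto
  qed
  then show ?thesis by (rule bij_betw_same_card)
qed

text \<open>Two of the lines in \<open>K\<close> already meet in \<open>c\<close>, hence not again on \<open>l\<close>.\<close>

lemma card_meets:
  assumes l: "l \<in> \<L>" and c: "c \<notin> l" and K: "K \<subseteq> \<L>" "\<And>k. k \<in> K \<Longrightarrow> c \<in> k"
  shows "card {v. \<exists>k\<in>K. v \<in> l \<and> v \<in> k} = card K"
proof -
  have ne: "l \<noteq> k" if "k \<in> K" for k using that c K by auto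
  have in_pt: "pt l k \<in> l" "pt l k \<in> k" if "k \<in> K" for k
    using pt_in[of l k] ne[OF that] l K that by auto
  have "bij_betw (pt l) K {v. \<exists>k\<in>K. v \<in> l \<and> v \<in> k}"
  proof (rule bij_betw_imageI)
    show "inj_on (pt l) K"
    proof (rule inj_onI)
      fix j k assume jk: "j \<in> K" "k \<in> K" "pt l j = pt l k"
      then show "j = k"
        using line_eqI[of j k c "pt l j"] in_pt[of j] in_pt[of k] K c by auto
    qed
    show "pt l ` K = {v. \<exists>k\<in>K. v \<in> l \<and> v \<in> k}"
    proof
      show "pt l ` K \<subseteq> {v. \<exists>k\<in>K. v \<in> l \<and> v \<in> k}" using in_pt by blast
      show "{v. \<exists>k\<in>K. v \<in> l \<and> v \<in> k} \<subseteq> pt l ` K"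
      proof
        fix v assume "v \<in> {v. \<exists>k\<in>K. v \<in> l \<and> v \<in> k}"
        then obtain k where "k \<in> K" "v \<in> l" "v \<in> k" by blast
        then show "v \<in> pt l ` K" using pt_eq[of l k v] l K ne by (intro image_eqI[of _ _ k]) auto
      qed
    qed
  qed
  then show ?thesis by (rule bij_betw_same_card[symmetric])
qed

section \<open>Loans between lines\<close>

text \<open>The lines with \<open>z \<in> F\<close> and \<open>y \<in> R\<close> lend at the points in \<open>T\<close>, those with \<open>z \<notin> F\<close> and \<open>y \<notin> R\<close> borrow at
  the points in \<open>S\<close>. Excluding both axes makes the notion symmetric in them.\<close>

definition balanced_loans where
  "balanced_loans h F R T S \<longleftrightarrow>
    (\<forall>l\<in>N. z l \<in> F \<and> y l \<in> R \<longrightarrow> T l \<subseteq> l - l0 - m0 \<and> card (T l) = h) \<and>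
    (\<forall>l\<in>N. z l \<notin> F \<and> y l \<notin> R \<longrightarrow> S l \<subseteq> l - l0 - m0 \<and> card (S l) = h) \<and>
    (\<forall>v. card {l \<in> N. z l \<notin> F \<and> y l \<notin> R \<and> v \<in> S l} \<le> card {l \<in> N. z l \<in> F \<and> y l \<in> R \<and> v \<in> T l})"

text \<open>Loans are made at intersection points of a lender \<open>l\<close> and a borrower \<open>k\<close>, so it suffices to choose
  partners such that each line has \<open>h\<close> of them and meets them in different points. Let \<open>\<sigma>\<close> be a
  bijection from \<open>R\<close> to the points of the first axis outside \<open>F\<close>. The lender \<open>l\<close> deals only with lines
  \<open>k\<close> through \<open>\<sigma> (y l)\<close>. These are concurrent in a point off \<open>l\<close>, and the partners of \<open>k\<close> are concurrent in
  a point of \<open>R\<close> off \<open>k\<close>. Under this restriction \<open>z l \<in> F\<close> and \<open>y k \<notin> R\<close> can still be combined freely,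
  and there are \<open>card F\<close> choices for either, so an \<open>h\<close>-regular relation between them exists.\<close>

lemma ex_balanced_loans_aux:
  assumes F: "F \<subseteq> A" and R: "R \<subseteq> B" and FR: "card F + card R = q" and h: "h \<le> card F"
  shows "\<exists>T S. balanced_loans h F R T S"
proof -
  have finF: "finite F" "finite R" using F R finite_A finite_B by (auto intro: finite_subset)
  have "card (A - F) = card R" using F FR finF card_A by (simp add: card_Diff_subset)
  then obtain \<sigma> where \<sigma>: "bij_betw \<sigma> R (A - F)"
    using ex_bij_finite_same_card[of R "A - F"] finF finite_A by auto
  have "card (B - R) = card F" using R FR finF card_B by (simp add: card_Diff_subset)
  then obtain \<rho> where \<rho>: "\<And>u. u \<in> F \<Longrightarrow> card {v \<in> B - R. \<rho> u v} = h"
    "\<And>v. v \<in> B - R \<Longrightarrow> card {u \<in> F. \<rho> u v} = h"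
    using ex_biregular_relation[of F "card F" "B - R" h] finF finite_B h by auto
  define D where "D l = {k \<in> N. z k = \<sigma> (y l) \<and> y k \<in> {v \<in> B - R. \<rho> (z l) v}}" for l
  define T where "T l = {v. \<exists>k\<in>D l. v \<in> l \<and> v \<in> k}" for l
  define D' where "D' k = {l \<in> N. y l = inv_into R \<sigma> (z k) \<and> z l \<in> {u \<in> F. \<rho> u (y k)}}" for k
  define S where "S k = {v. \<exists>l\<in>D' k. v \<in> k \<and> v \<in> l}" for k
  have \<sigma>_in: "\<sigma> u \<in> A - F" if "u \<in> R" for u using \<sigma> that by (auto simp: bij_betw_def)
  have \<sigma>_inv: "inv_into R \<sigma> u \<in> R" "\<sigma> (inv_into R \<sigma> u) = u" if "u \<in> A - F" for u
    using \<sigma> that by (auto simp: bij_betw_def inv_into_into f_inv_into_f)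
  have DD': "k \<in> D l \<longleftrightarrow> l \<in> D' k"
    if "l \<in> N" "z l \<in> F" "y l \<in> R" "k \<in> N" "z k \<in> A - F" "y k \<in> B - R" for l k
    using that \<sigma> \<sigma>_inv[of "z k"] by (auto simp: D_def D'_def bij_betw_def)
  have "T l \<subseteq> l - l0 - m0 \<and> card (T l) = h" if l: "l \<in> N" "z l \<in> F" "y l \<in> R" for l
  proof
    have "v \<notin> l0 \<and> v \<notin> m0" if "k \<in> D l" "v \<in> l" "v \<in> k" for k v
      using that l z_eq[of l v] z_eq[of k v] y_eq[of l v] y_eq[of k v] \<sigma>_in[OF l(3)]
      by (auto simp: D_def)
    then show "T l \<subseteq> l - l0 - m0" by (auto simp: T_def)
    have "\<sigma> (y l) \<notin> l" using z_eq[OF l(1), of "\<sigma> (y l)"] \<sigma>_in[OF l(3)] l(2) by auto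
    moreover have "\<sigma> (y l) \<in> k" if "k \<in> D l" for k using that N_D(6)[of k] by (auto simp: D_def)
    ultimately have "card (T l) = card (D l)"
      unfolding T_def using N_D(1)[OF l(1)] by (intro card_meets[where c = "\<sigma> (y l)"]) (auto simp: D_def N_def)
    also have "\<dots> = h"
      unfolding D_def using \<sigma>_in[OF l(3)] \<rho>(1)[OF l(2)] by (subst card_N_y) auto
    finally show "card (T l) = h" .
  qed
  moreover have "S k \<subseteq> k - l0 - m0 \<and> card (S k) = h" if k: "k \<in> N" "z k \<notin> F" "y k \<notin> R" for k
  proof
    define c where "c = inv_into R \<sigma> (z k)"
    have zk: "z k \<in> A - F" "y k \<in> B - R" using k N_D(5,7)[OF k(1)] by auto
    have c: "c \<in> R" using \<sigma>_inv[OF zk(1)] by (simp add: c_def)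
    have "v \<notin> l0 \<and> v \<notin> m0" if v: "l \<in> D' k" "v \<in> k" "v \<in> l" for l v
    proof -
      have l: "l \<in> N" "z l \<in> F" "y l \<in> R" using v(1) c by (simp_all add: D'_def c_def[symmetric])
      have "z l \<noteq> z k" "y l \<noteq> y k" using l k by auto
      then show ?thesis
        using z_eq[OF l(1) v(3)] z_eq[OF k(1) v(2)] y_eq[OF l(1) v(3)] y_eq[OF k(1) v(2)] by auto
    qed
    then show "S k \<subseteq> k - l0 - m0" by (auto simp: S_def)
    have "c \<notin> k" using y_eq[OF k(1), of c] c k(3) R by auto
    moreover have "c \<in> l" if "l \<in> D' k" for l using that N_D(8)[of l] by (auto simp: D'_def c_def)
    ultimately have "card (S k) = card (D' k)"
      unfolding S_def using N_D(1)[OF k(1)] by (intro card_meets[where c = c]) (auto simp: D'_def N_def)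
    also have "\<dots> = h"
      unfolding D'_def c_def[symmetric] using c R F \<rho>(2)[OF zk(2)] by (subst card_N_z) auto
    finally show "card (S k) = h" .
  qed
  moreover have "card {k \<in> N. z k \<notin> F \<and> y k \<notin> R \<and> v \<in> S k}
      \<le> card {l \<in> N. z l \<in> F \<and> y l \<in> R \<and> v \<in> T l}" for v
  proof -
    \<comment> \<open>The lender from which a line borrows at v; it determines the borrower as the line joining v to the common point of its partners.\<close>
    define f where "f k = (SOME l. l \<in> D' k \<and> v \<in> k \<and> v \<in> l)" for k
    have f: "f k \<in> D' k" "v \<in> k" "v \<in> f k" if "v \<in> S k" for k
    proof -
      have "\<exists>l. l \<in> D' k \<and> v \<in> k \<and> v \<in> l" using that by (auto simp: S_def)
      from someI_ex[OF this, folded f_def] show "f k \<in> D' k" "v \<in> k" "v \<in> f k" by blast+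
    qed
    have fk: "f k \<in> N" "z (f k) \<in> F" "y (f k) \<in> R" "k \<in> D (f k)"
      if k: "k \<in> N" "z k \<notin> F" "y k \<notin> R" "v \<in> S k" for k
    proof -
      have zk: "z k \<in> A - F" "y k \<in> B - R" using k N_D(5,7)[OF k(1)] by auto
      show 1: "f k \<in> N" "z (f k) \<in> F" "y (f k) \<in> R"
        using f(1)[OF k(4)] \<sigma>_inv[OF zk(1)] by (auto simp: D'_def)
      show "k \<in> D (f k)" using DD'[OF 1 k(1) zk] f(1)[OF k(4)] by simp
    qed
    show ?thesis
    proof (rule card_inj_on_le)
      show "inj_on f {k \<in> N. z k \<notin> F \<and> y k \<notin> R \<and> v \<in> S k}"
      proof (rule inj_onI, clarify)
        fix j k assume j: "j \<in> N" "z j \<notin> F" "y j \<notin> R" "v \<in> S j"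
          and k: "k \<in> N" "z k \<notin> F" "y k \<notin> R" "v \<in> S k" and eq: "f j = f k"
        have zz: "z j = z k" using fk(4)[OF j] fk(4)[OF k] eq by (simp add: D_def)
        have "v \<in> j" "v \<in> k" "v \<in> f k" using f(2)[OF j(4)] f(2,3)[OF k(4)] by auto
        moreover have "v \<noteq> z k"
          using z_eq[OF fk(1)[OF k] \<open>v \<in> f k\<close>] fk(2)[OF k] k(2) N_D(5)[OF k(1)] by auto
        ultimately show "j = k"
          using line_eqI[of j k v "z k"] N_D(1,6)[OF j(1)] N_D(1,6)[OF k(1)] zz by auto
      qed
      show "f ` {k \<in> N. z k \<notin> F \<and> y k \<notin> R \<and> v \<in> S k} \<subseteq> {l \<in> N. z l \<in> F \<and> y l \<in> R \<and> v \<in> T l}"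
      proof (rule image_subsetI, clarify)
        fix k assume k: "k \<in> N" "z k \<notin> F" "y k \<notin> R" "v \<in> S k"
        have "v \<in> T (f k)" using fk(4)[OF k] f(2,3)[OF k(4)] by (auto simp: T_def)
        then show "f k \<in> N \<and> z (f k) \<in> F \<and> y (f k) \<in> R \<and> v \<in> T (f k)" using fk(1-3)[OF k] by simp
      qed
      show "finite {l \<in> N. z l \<in> F \<and> y l \<in> R \<and> v \<in> T l}"
        using finite_lines by (simp add: N_def)
    qed
  qed
  ultimately have "balanced_loans h F R T S" by (simp add: balanced_loans_def)
  then show ?thesis by blast
qed

text \<open>If \<open>F\<close> has fewer than \<open>h\<close> points, then \<open>R\<close> has at least \<open>h\<close>, and the two axes can exchange their
  roles.\<close>

lemma ex_balanced_loans:
  assumes F: "F \<subseteq> A" and R: "R \<subseteq> B" and FR: "card F + card R = q" and h: "2 * h \<le> q"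
  shows "\<exists>T S. balanced_loans h F R T S"
proof (cases "h \<le> card F")
  case True
  then show ?thesis using ex_balanced_loans_aux[OF F R FR] by blast
next
  case False
  interpret swap: framed_plane P \<L> q m0 l0 x0
    by unfold_locales (use l0 m0 l0_m0 x0_l0 x0_m0 in auto)
  have "h \<le> card R" "card R + card F = q" using False FR h by auto
  then obtain T S where "swap.balanced_loans h R F T S"
    using swap.ex_balanced_loans_aux[OF R F] by blast
  moreover have "swap.N = N" by (simp add: N_def swap.N_def)
  moreover have "l - m0 - l0 = l - l0 - m0" for l by blast
  ultimately have "balanced_loans h F R T S"
    by (simp add: swap.balanced_loans_def balanced_loans_def conj_commute conj_left_commute)
  then show ?thesis by blast
qed

end

section \<open>The colouring for nonnegative a\<close>

text \<open>The data of the construction. The vertices of \<open>W\<close> are assigned bijectively to the points of \<open>F\<close> by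
  \<open>wz\<close> and to the points of the second axis outside \<open>R\<close> by \<open>wy\<close>. The set \<open>X1\<close> splits the points of
  \<open>X\<close> other than \<open>x0\<close> into two parts of size at most \<open>h\<close>.\<close>

locale loan_construction = framed_plane P \<L> q l0 m0 x0
  for P :: "'v set" and \<L> q l0 m0 x0 +
  fixes h a :: nat and W F R X1 :: "'v set" and wz wy :: "'v \<Rightarrow> 'v" and T S :: "'v set \<Rightarrow> 'v set"
  assumes q: "q = 2 * h" and h: "h > 0"
    and W: "finite W" "W \<inter> P = {}"
    and F: "F \<subseteq> A" "card F + a = q" and R: "R \<subseteq> B" "card R = a"
    and wz: "bij_betw wz F W" and wy: "bij_betw wy (B - R) W"
    and X1: "X1 \<subseteq> A - F" "card X1 \<le> h" "card (A - F - X1) \<le> h"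
    and loans: "balanced_loans h F R T S"
begin

text \<open>Edges inside \<open>X\<close> belong to both \<open>l0\<close> and \<open>W \<union> X\<close> and are shared out: \<open>W \<union> X\<close> receives those in
  \<open>Z1\<close>, and \<open>l0\<close> receives those in \<open>Z2\<close>. Splitting the edges at \<open>x0\<close> in this way ensures that neither
  part loses more than \<open>h\<close> of them, as \<open>scheme_centred\<close> requires.\<close>

definition X where "X = l0 - F"
definition Z1 where "Z1 = {{x0, v} |v. v \<in> X1}"
definition Z2 where "Z2 = pairs X - Z1"
definition W_partner where "W_partner l v = (if v = z l then wy (y l) else wz (z l))"
definition star where
  "star l = (if l \<in> N \<and> z l \<in> F then {{v, W_partner l v} |v. v \<in> (if y l \<in> R then l - {z l} else l)} else {})"

text \<open>Schemes are indexed by lines; the index \<open>None\<close> stands for the vertex set \<open>W \<union> X\<close>.\<close>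

definition edges :: "'v set option \<Rightarrow> 'v set set" where
  "edges s = (case s of None \<Rightarrow> pairs (W \<union> X) - Z2
     | Some l \<Rightarrow> (if l = l0 then pairs l0 - Z1 else pairs l \<union> star l))"

definition colours :: "'v set option \<Rightarrow> nat" where
  "colours s = (case s of None \<Rightarrow> q
     | Some l \<Rightarrow> (if l = l0 then q else if l \<notin> N then q - 1
         else q + of_bool (z l \<in> F) - of_bool (y l \<in> R)))"

definition spans :: "'v set option \<Rightarrow> 'v set set" where
  "spans s = (case s of None \<Rightarrow> {W \<union> X}
     | Some l \<Rightarrow> (if l \<in> N \<and> z l \<in> F then {insert w l |w. w \<in> W} else {l}))"

definition debt :: "'v set option \<Rightarrow> 'v \<Rightarrow> nat" where
  "debt s v = (case s of None \<Rightarrow> (if v = x0 then h else card {e \<in> Z2. v \<in> e})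
     | Some l \<Rightarrow> (if l = l0 then (if v = x0 then h else card {e \<in> Z1. v \<in> e})
         else of_bool (l \<in> N \<and> z l \<notin> F \<and> y l \<notin> R \<and> v \<in> S l)))"

definition credit :: "'v set option \<Rightarrow> 'v \<Rightarrow> nat" where
  "credit s v = (case s of None \<Rightarrow> 0
     | Some l \<Rightarrow> (if l = l0 then 0 else if l \<notin> N then of_bool (v = x0)
         else of_bool (y l \<in> R \<and> (if z l \<in> F then v \<in> T l else v = z l))))"

lemma basic:
  shows "x0 \<in> X" "X \<subseteq> l0" "X \<subseteq> P" "X1 \<subseteq> X" "x0 \<notin> X1" "finite X" "card W + a = q"
    "W \<inter> X = {}" "X - {x0} = A - F" "card X = Suc a"
proof -
  show 1: "x0 \<in> X" "X \<subseteq> l0" "X1 \<subseteq> X" "x0 \<notin> X1" "X - {x0} = A - F"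
    using F X1 x0_l0 by (auto simp: X_def)
  then show "X \<subseteq> P" using line_sub[OF l0] by blast
  then show "W \<inter> X = {}" using W by blast
  show "finite X" using 1 finite_line[OF l0] finite_subset by blast
  show "card W + a = q" using F wz by (simp add: bij_betw_same_card)
  have "finite F" using F finite_A finite_subset by blast
  then have "card X = card l0 - card F" using F unfolding X_def by (intro card_Diff_subset) auto
  then show "card X = Suc a" using F card_line[OF l0] by simp
qed

lemma Z1_sub: "Z1 \<subseteq> pairs X"
  using basic by (auto simp: Z1_def)

lemma line_W: "l \<in> \<L> \<Longrightarrow> l \<inter> W = {}"
  using line_sub W by blast

lemma W_partner_in_W: "l \<in> N \<Longrightarrow> z l \<in> F \<Longrightarrow> v \<in> (if y l \<in> R then l - {z l} else l) \<Longrightarrow> W_partner l v \<in> W"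
  using wz wy N_D(7)[of l] by (auto simp: W_partner_def bij_betw_def split: if_splits)

lemma starE:
  assumes "e \<in> star l"
  obtains v where "l \<in> N" "z l \<in> F" "e = {v, W_partner l v}" "v \<in> l" "v \<in> P" "W_partner l v \<in> W" "v = z l \<Longrightarrow> y l \<in> B - R"
proof -
  have l: "l \<in> N" "z l \<in> F" using assms by (auto simp: star_def split: if_splits)
  then obtain v where v: "v \<in> (if y l \<in> R then l - {z l} else l)" "e = {v, W_partner l v}"
    using assms by (auto simp: star_def)
  then have "v \<in> l" "v = z l \<Longrightarrow> y l \<in> B - R" using N_D(7)[OF l(1)] by (auto split: if_splits)
  moreover have "v \<in> P" using \<open>v \<in> l\<close> line_sub N_D(1)[OF l(1)] by blast
  ultimately show ?thesis using that l v W_partner_in_W[OF l v(1)] by blast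
qed

lemma edges_sub: "s \<in> insert None (Some ` \<L>) \<Longrightarrow> edges s \<subseteq> pairs (P \<union> W)"
proof -
  assume s: "s \<in> insert None (Some ` \<L>)"
  show ?thesis
  proof (cases s)
    case None
    have "pairs (W \<union> X) \<subseteq> pairs (P \<union> W)" using basic by (intro pairs_mono) auto
    then show ?thesis using None by (auto simp: edges_def)
  next
    case (Some l)
    then have l: "l \<in> \<L>" using s by auto
    have "star l \<subseteq> pairs (P \<union> W)"
    proof
      fix e assume "e \<in> star l"
      then show "e \<in> pairs (P \<union> W)" using W by (elim starE) auto
    qed
    moreover have "pairs l \<subseteq> pairs (P \<union> W)" using line_sub[OF l] by (intro pairs_mono) auto
    ultimately show ?thesis using Some by (auto simp: edges_def)
  qed
qed

lemma star_pairs: "k \<in> \<L> \<Longrightarrow> star l \<inter> pairs k = {}"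
proof -
  assume k: "k \<in> \<L>"
  have "e \<notin> pairs k" if "e \<in> star l" for e
    using that line_W[OF k] by (elim starE) auto
  then show ?thesis by blast
qed

text \<open>The edges joining the lines to \<open>W\<close> do not collide. Off \<open>l0\<close>, the end in \<open>W\<close> determines \<open>z l\<close> and hence
  the line; on \<open>l0\<close>, the end in the plane is \<open>z l\<close> itself and the end in \<open>W\<close> determines \<open>y l\<close>.\<close>

lemma star_star: "l \<noteq> k \<Longrightarrow> star l \<inter> star k = {}"
proof -
  assume ne: "l \<noteq> k"
  have False if "e \<in> star l" "e \<in> star k" for e
  proof -
    from that(1) obtain v where v: "l \<in> N" "z l \<in> F" "e = {v, W_partner l v}" "v \<in> l" "v \<in> P"
      "W_partner l v \<in> W" "v = z l \<Longrightarrow> y l \<in> B - R" by (rule starE) blast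
    from \<open>e \<in> star k\<close> obtain u where u: "k \<in> N" "z k \<in> F" "e = {u, W_partner k u}" "u \<in> k" "u \<in> P"
      "W_partner k u \<in> W" "u = z k \<Longrightarrow> y k \<in> B - R" by (rule starE) blast
    have eq: "v = u" "W_partner l v = W_partner k v" using u v W by (auto simp: doubleton_eq_iff)
    show False
    proof (cases "v = z l")
      case True
      then have "v \<in> l0" using N_D(5)[OF v(1)] by simp
      then have "v = z k" using z_eq[OF u(1)] u(4) eq by simp
      then have "wy (y l) = wy (y k)" using eq True by (simp add: W_partner_def)
      then have "y l = y k" using wy v(7) u(7) True \<open>v = z k\<close> eq by (auto simp: bij_betw_def inj_on_def)
      then show False using N_eqI[OF v(1) u(1)] True \<open>v = z k\<close> ne by simp
    next
      case False
      have "v \<notin> l0" using z_eq[OF v(1,4)] False by auto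
      then have "v \<noteq> z k" using N_D(5)[OF u(1)] by auto
      then have "wz (z l) = wz (z k)" using eq False by (simp add: W_partner_def)
      then have "z l = z k" using wz v(2) u(2) by (auto simp: bij_betw_def inj_on_def)
      then show False
        using line_eqI[of l k v "z l"] N_D(1,6)[OF v(1)] N_D(1,6)[OF u(1)] v u eq False ne by auto
    qed
  qed
  then show ?thesis by blast
qed

lemma edges_Some: "edges (Some l) \<subseteq> pairs l \<union> star l"
  by (auto simp: edges_def)

lemma edges_None_Some: "l \<in> \<L> \<Longrightarrow> edges None \<inter> edges (Some l) = {}"
proof -
  assume l: "l \<in> \<L>"
  have "e \<notin> edges (Some l)" if e: "e \<in> pairs (W \<union> X)" "e \<notin> Z2" for e
  proof
    assume "e \<in> edges (Some l)"
    then consider "e \<in> pairs l" | "e \<in> star l" using edges_Some by blast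
    then show False
    proof cases
      case 1
      then have "e \<in> pairs X" using e line_W[OF l] by (auto simp: pairs_def)
      then have "e \<in> pairs l0" "e \<in> Z1" using e basic pairs_mono[of X l0] by (auto simp: Z2_def)
      then have "l = l0" using 1 pairs_lines_disjoint[OF l l0] by blast
      then show False using \<open>e \<in> edges (Some l)\<close> \<open>e \<in> Z1\<close> by (simp add: edges_def)
    next
      case 2
      then obtain v where v: "l \<in> N" "z l \<in> F" "e = {v, W_partner l v}" "v \<in> l" "v \<in> P" by (rule starE) blast
      then have "v \<in> X" using e W by auto
      then have "v = z l" "v \<notin> F" using z_eq[OF v(1,4)] by (auto simp: X_def)
      then show False using v(2) by simp
    qed
  qed
  moreover have "edges None = pairs (W \<union> X) - Z2" by (simp add: edges_def)
  ultimately show ?thesis by blast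
qed

lemma edges_disjoint: "disjoint_family_on edges (insert None (Some ` \<L>))"
proof -
  have "edges (Some l) \<inter> edges (Some k) = {}" if "l \<in> \<L>" "k \<in> \<L>" "l \<noteq> k" for l k
    using edges_Some[of l] edges_Some[of k] pairs_lines_disjoint[OF that] star_star[OF that(3)]
      star_pairs[OF that(1), of k] star_pairs[OF that(2), of l] by blast
  then show ?thesis using edges_None_Some by (rule disjoint_family_on_optionI)
qed

lemma schemes:
  assumes "s \<in> insert None (Some ` \<L>)"
  shows "scheme (edges s) (colours s) (spans s) (debt s) (credit s)"
proof (cases s)
  case None
  have "card (W \<union> X) = 2 * h + 1"
    using basic W q by (subst card_Un_disjoint) auto
  moreover have "{x0, v} \<in> Z2 \<longleftrightarrow> v \<in> A - F - X1" for v
    using basic by (auto simp: Z2_def Z1_def doubleton_eq_iff)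
  then have "{v \<in> W \<union> X. {x0, v} \<in> Z2} = A - F - X1" using basic by blast
  moreover have "Z2 \<subseteq> pairs (W \<union> X)" using pairs_mono[of X "W \<union> X"] by (auto simp: Z2_def)
  ultimately have "scheme (pairs (W \<union> X) - Z2) (2*h) {W \<union> X}
      (\<lambda>v. if v = x0 then h else card {e \<in> Z2. v \<in> e}) (\<lambda>_. 0)"
    using h basic W X1 by (intro scheme_centred) auto
  then show ?thesis
    using None by (simp add: q[symmetric] edges_def colours_def spans_def debt_def[abs_def] credit_def[abs_def])
next
  case (Some l)
  then have l: "l \<in> \<L>" using assms by auto
  have fl: "finite l" "card l = 2*h+1" using finite_line[OF l] card_line[OF l] q by auto
  show ?thesis
  proof (cases "l \<in> N")
    case False
    show ?thesis
    proof (cases "l = l0")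
      case True
      have "{x0, v} \<in> Z1 \<longleftrightarrow> v \<in> X1" for v using basic by (auto simp: Z1_def doubleton_eq_iff)
      then have "{v \<in> l0. {x0, v} \<in> Z1} = X1" using basic by blast
      moreover have "Z1 \<subseteq> pairs l0" using Z1_sub basic pairs_mono[of X l0] by blast
      ultimately have "scheme (pairs l0 - Z1) (2*h) {l0}
          (\<lambda>v. if v = x0 then h else card {e \<in> Z1. v \<in> e}) (\<lambda>_. 0)"
        using h fl True x0_l0 X1 by (intro scheme_centred) auto
      then show ?thesis
        using Some True N_D(2)[of l0]
        by (auto simp: q[symmetric] edges_def colours_def spans_def debt_def[abs_def] credit_def[abs_def])
    next
      case ne: False
      have "x0 \<in> l" using False l by (simp add: N_def)
      then have "scheme (pairs l) (2*h - 1) {l} (\<lambda>_. 0) (\<lambda>v. of_bool (v = x0))"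
        using scheme_edge_covers[OF fl h] by blast
      then show ?thesis
        using Some False ne
        by (simp add: q[symmetric] edges_def colours_def spans_def debt_def[abs_def] credit_def[abs_def] star_def)
    qed
  next
    case lN: True
    note lD = N_D[OF lN]
    show ?thesis
    proof (cases "z l \<in> F")
      case zF: True
      then have wzW: "wz (z l) \<in> W" using wz by (auto simp: bij_betw_def)
      show ?thesis
      proof (cases "y l \<in> R")
        case True
        then have T: "T l \<subseteq> l - {z l}" "card (T l) = h"
          using loans lN zF lD by (auto simp: balanced_loans_def)
        have "scheme (pairs l \<union> {{v, wz (z l)} |v. v \<in> l - {z l}}) (2*h) {insert (wz (z l)) l}
          (\<lambda>_. 0) (\<lambda>v. of_bool (v \<in> T l))"
          using wzW line_W[OF l] by (intro scheme_lender[OF fl lD(6) T]) auto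
        moreover have "star l = {{v, wz (z l)} |v. v \<in> l - {z l}}"
          using lN zF True by (auto simp: star_def W_partner_def)
        ultimately have "scheme (edges s) (colours s) {insert (wz (z l)) l} (debt s) (credit s)"
          using Some lN zF True lD(2)
          by (simp add: q[symmetric] edges_def colours_def debt_def[abs_def] credit_def[abs_def])
        then show ?thesis
          by (rule scheme_mono) (use Some lN zF wzW in \<open>auto simp: spans_def\<close>)
      next
        case False
        have W_partner: "W_partner l v \<in> W" if "v \<in> l" for v using W_partner_in_W[OF lN zF] that False by simp
        have "scheme (pairs l \<union> {{v, W_partner l v} |v. v \<in> l}) (card l) {insert (W_partner l v) l |v. v \<in> l}
          (\<lambda>_. 0) (\<lambda>_. 0)"
          using fl W_partner line_W[OF l] by (intro scheme_full) auto
        then have "scheme (edges s) (colours s) {insert (W_partner l v) l |v. v \<in> l} (debt s) (credit s)"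
          using Some lN zF False lD(2) fl
          by (simp add: q[symmetric] edges_def colours_def debt_def[abs_def] credit_def[abs_def] star_def)
        then show ?thesis
          by (rule scheme_mono) (use Some lN zF W_partner in \<open>auto simp: spans_def\<close>)
      qed
    next
      case zF: False
      show ?thesis
      proof (cases "y l \<in> R")
        case True
        have "scheme (pairs l) (2*h - 1) {l} (\<lambda>_. 0) (\<lambda>v. of_bool (v = z l))"
          by (rule scheme_edge_covers[OF fl h lD(6)])
        then show ?thesis
          using Some lN zF True lD(2)
          by (simp add: q[symmetric] edges_def colours_def spans_def debt_def[abs_def] credit_def[abs_def] star_def)
      next
        case False
        then have S: "S l \<subseteq> l - {z l}" "card (S l) = h"
          using loans lN zF lD by (auto simp: balanced_loans_def)
        have "scheme (pairs l) (2*h) {l} (\<lambda>v. of_bool (v \<in> S l)) (\<lambda>_. 0)"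
          by (rule scheme_borrower[OF fl lD(6) S])
        then show ?thesis
          using Some lN zF False lD(2)
          by (simp add: q[symmetric] edges_def colours_def spans_def debt_def[abs_def] credit_def[abs_def] star_def)
      qed
    qed
  qed
qed

lemma spans_meet:
  assumes "s \<in> insert None (Some ` \<L>)" "t \<in> insert None (Some ` \<L>)" "U \<in> spans s" "V \<in> spans t"
  shows "U \<inter> V \<noteq> {}"
proof -
  have l: "l \<subseteq> U" if "U \<in> spans (Some l)" for l U
    using that by (auto simp: spans_def split: if_splits)
  have none: "U \<inter> (W \<union> X) \<noteq> {}" if U: "l \<in> \<L>" "U \<in> spans (Some l)" for l U
  proof (cases "l \<in> N \<and> z l \<in> F")
    case True
    then show ?thesis using U(2) by (auto simp: spans_def)
  next
    case False
    have "l \<inter> X \<noteq> {}"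
    proof (cases "l \<in> N")
      case True
      then have "z l \<in> X" "z l \<in> l" using False N_D(5,6)[OF True] by (auto simp: X_def)
      then show ?thesis by blast
    next
      case False
      then show ?thesis using U(1) basic by (auto simp: N_def)
    qed
    then show ?thesis using l[OF U(2)] by blast
  qed
  show ?thesis
  proof (cases s; cases t)
    assume "s = None" "t = None"
    then show ?thesis using assms basic by (auto simp: spans_def)
  next
    fix k assume "s = None" "t = Some k"
    then show ?thesis using assms none[of k V] by (auto simp: spans_def)
  next
    fix k assume "s = Some k" "t = None"
    then show ?thesis using assms none[of k U] by (auto simp: spans_def)
  next
    fix j k assume "s = Some j" "t = Some k"
    then show ?thesis using assms l[of U j] l[of V k] lines_meet[of j k] by auto
  qed
qed

lemma sum_index:
  fixes f :: "'v set option \<Rightarrow> nat"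
  shows "(\<Sum>s\<in>insert None (Some ` \<L>). f s) = f None + f (Some l0) + (\<Sum>l\<in>\<L> - {l0}. f (Some l))"
  using finite_lines l0 by (simp add: sum.reindex sum.remove[of \<L> l0])

lemma card_le_sum:
  fixes f :: "'b \<Rightarrow> nat"
  assumes "finite C" "Q \<subseteq> C" "\<And>x. x \<in> Q \<Longrightarrow> 1 \<le> f x"
  shows "card Q \<le> sum f C"
proof -
  have "card Q = (\<Sum>x\<in>Q. 1)" by simp
  also have "\<dots> \<le> sum f Q" using assms(3) by (intro sum_mono)
  also have "\<dots> \<le> sum f C" using assms by (intro sum_mono2) auto
  finally show ?thesis .
qed

lemma card_through_N: "card {l \<in> \<L> - {l0}. x0 \<in> l} = q"
proof -
  have "{l \<in> \<L> - {l0}. x0 \<in> l} = {l \<in> \<L>. x0 \<in> l} - {l0}" by blast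
  then show ?thesis using card_through[OF x0_P] l0 x0_l0 finite_lines by simp
qed

text \<open>At \<open>x0\<close>, the debts \<open>h + h\<close> of \<open>l0\<close> and \<open>W \<union> X\<close> are paid by the \<open>q\<close> other lines through \<open>x0\<close>. At another
  point of \<open>X\<close>, each of the \<open>a\<close> edges to the rest of \<open>X\<close> is missing from exactly one of \<open>l0\<close> and \<open>W \<union> X\<close>, and
  these debts are paid by the \<open>a\<close> lines joining the point to \<open>R\<close>. Everywhere else only the balanced loans matter.\<close>

lemma balance:
  "(\<Sum>s\<in>insert None (Some ` \<L>). debt s v) \<le> (\<Sum>s\<in>insert None (Some ` \<L>). credit s v)"
proof -
  let ?K = "{l \<in> N. z l \<notin> F \<and> y l \<notin> R \<and> v \<in> S l}"
  have KN: "l \<noteq> l0" if "l \<in> N" for l using that N_D(2) by blast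
  have "(\<Sum>l\<in>\<L> - {l0}. debt (Some l) v) = (\<Sum>l\<in>\<L> - {l0}. of_bool (l \<in> ?K))"
    by (intro sum.cong) (auto simp: debt_def)
  also have "\<dots> = card ((\<L> - {l0}) \<inter> ?K)" using finite_lines by (simp add: sum.If_cases of_bool_def)
  also have "(\<L> - {l0}) \<inter> ?K = ?K" using KN by (auto simp: N_def)
  finally have D: "(\<Sum>s\<in>insert None (Some ` \<L>). debt s v) = debt None v + debt (Some l0) v + card ?K"
    by (simp add: sum_index)
  have S0: "card ?K = 0" if "v \<in> l0"
  proof -
    have "?K = {}" using loans that by (auto simp: balanced_loans_def)
    then show ?thesis by (simp only: card.empty)
  qed
  have C: "card Q \<le> (\<Sum>s\<in>insert None (Some ` \<L>). credit s v)"
    if "Q \<subseteq> \<L> - {l0}" "\<And>l. l \<in> Q \<Longrightarrow> 1 \<le> credit (Some l) v" for Q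
    using card_le_sum[of "\<L> - {l0}" Q "\<lambda>l. credit (Some l) v"] that finite_lines
    by (simp add: sum_index)
  have finZ: "finite Z1" "finite Z2"
    using Z1_sub finite_pairs[OF basic(6)] by (auto simp: Z2_def intro: finite_subset)
  consider "v = x0" | "v \<in> X - {x0}" | "v \<notin> X" by blast
  then show ?thesis
  proof cases
    case 1
    have "card {l \<in> \<L> - {l0}. x0 \<in> l} \<le> (\<Sum>s\<in>insert None (Some ` \<L>). credit s v)"
      using 1 by (intro C) (auto simp: credit_def N_def)
    moreover have "debt None v = h" "debt (Some l0) v = h" using 1 by (simp_all add: debt_def)
    moreover have "card ?K = 0" using 1 x0_l0 by (intro S0) simp
    ultimately show ?thesis using D card_through_N q by linarith
  next
    case 2
    then have v: "v \<in> A" "v \<notin> F" "v \<in> l0" "v \<in> X" using basic by auto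
    have "a = card {l \<in> N. z l = v \<and> y l \<in> R}" using card_N_y[OF v(1) R(1)] R(2) by simp
    also have "\<dots> \<le> (\<Sum>s\<in>insert None (Some ` \<L>). credit s v)"
      using v KN by (intro C) (auto simp: credit_def N_def)
    finally have "a \<le> (\<Sum>s\<in>insert None (Some ` \<L>). credit s v)" .
    note credit = this
    have "debt None v + debt (Some l0) v = card {e \<in> Z2. v \<in> e} + card {e \<in> Z1. v \<in> e}"
      using 2 by (simp add: debt_def)
    also have "\<dots> = card ({e \<in> Z2. v \<in> e} \<union> {e \<in> Z1. v \<in> e})"
      using finZ by (intro card_Un_disjoint[symmetric]) (auto simp: Z2_def)
    also have "{e \<in> Z2. v \<in> e} \<union> {e \<in> Z1. v \<in> e} = {e \<in> pairs X. v \<in> e}"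
      using Z1_sub by (auto simp: Z2_def)
    also have "{e \<in> pairs X. v \<in> e} = (\<lambda>u. {v, u}) ` (X - {v})"
      using v by (auto elim!: pairsE)
    also have "card \<dots> = card (X - {v})" by (intro card_image) (auto simp: inj_on_def doubleton_eq_iff)
    also have "\<dots> = a" using basic v by simp
    finally show ?thesis using credit D S0[OF v(3)] by linarith
  next
    case 3
    then have none: "{e \<in> Z2. v \<in> e} = {}" "{e \<in> Z1. v \<in> e} = {}" and "v \<noteq> x0"
      using Z1_sub basic by (auto simp: Z2_def pairs_def)
    have "card {e \<in> Z2. v \<in> e} = 0" "card {e \<in> Z1. v \<in> e} = 0" unfolding none by simp_all
    then have "debt None v + debt (Some l0) v = 0" using \<open>v \<noteq> x0\<close> by (simp add: debt_def)
    moreover have "card ?K \<le> card {l \<in> N. z l \<in> F \<and> y l \<in> R \<and> v \<in> T l}"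
      using loans by (simp add: balanced_loans_def)
    moreover have "card {l \<in> N. z l \<in> F \<and> y l \<in> R \<and> v \<in> T l} \<le> (\<Sum>s\<in>insert None (Some ` \<L>). credit s v)"
      using KN by (intro C) (auto simp: credit_def N_def)
    ultimately show ?thesis using D by linarith
  qed
qed

lemma count: "(\<Sum>s\<in>insert None (Some ` \<L>). colours s) + 2 * a * q = q * (q\<^sup>2 + 2 * q + 1)"
proof -
  define \<kappa> where "\<kappa> u v = q + of_bool (u \<in> F) - of_bool (v \<in> R)" for u v
  have \<kappa>: "\<kappa> u v + of_bool (v \<in> R) = q + of_bool (u \<in> F)" for u v
    using q h by (auto simp: \<kappa>_def)
  have NL: "\<L> - {l0} = {l \<in> \<L> - {l0}. x0 \<in> l} \<union> N" using x0_l0 by (auto simp: N_def)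
  have "(\<Sum>l\<in>\<L> - {l0}. colours (Some l)) =
      (\<Sum>l\<in>{l \<in> \<L> - {l0}. x0 \<in> l}. colours (Some l)) + (\<Sum>l\<in>N. colours (Some l))"
    using finite_lines by (subst NL, intro sum.union_disjoint) (auto simp: N_def)
  also have "(\<Sum>l\<in>{l \<in> \<L> - {l0}. x0 \<in> l}. colours (Some l)) = (\<Sum>l\<in>{l \<in> \<L> - {l0}. x0 \<in> l}. q - 1)"
    by (intro sum.cong) (auto simp: colours_def N_def)
  also have "\<dots> = q * (q - 1)" using card_through_N by simp
  also have "(\<Sum>l\<in>N. colours (Some l)) = (\<Sum>l\<in>N. case (z l, y l) of (u, v) \<Rightarrow> \<kappa> u v)"
    using N_D(2) by (intro sum.cong) (auto simp: colours_def \<kappa>_def)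
  also have "\<dots> = (\<Sum>(u, v)\<in>A \<times> B. \<kappa> u v)"
    by (rule sum.reindex_bij_betw[OF N_bij])
  finally have L: "(\<Sum>l\<in>\<L> - {l0}. colours (Some l)) = q * (q - 1) + (\<Sum>(u, v)\<in>A \<times> B. \<kappa> u v)" .
  have "(\<Sum>(u, v)\<in>A \<times> B. \<kappa> u v) + (\<Sum>(u, v)\<in>A \<times> B. of_bool (v \<in> R))
      = (\<Sum>(u, v)\<in>A \<times> B. q) + (\<Sum>(u, v)\<in>A \<times> B. of_bool (u \<in> F))"
    unfolding case_prod_unfold sum.distrib[symmetric] by (simp only: \<kappa>)
  moreover have "(\<Sum>(u, v)\<in>A \<times> B. of_bool (v \<in> R)) = q * a"
  proof -
    have "(\<Sum>v\<in>B. of_bool (v \<in> R)) = card (B \<inter> R)" using finite_B by (simp add: of_bool_def sum.If_cases)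
    moreover have "B \<inter> R = R" using R by blast
    ultimately show ?thesis using R card_A by (simp add: sum.cartesian_product[symmetric])
  qed
  moreover have "(\<Sum>(u, v)\<in>A \<times> B. of_bool (u \<in> F)) = card F * q"
  proof -
    have "(\<Sum>u\<in>A. of_bool (u \<in> F)) = card (A \<inter> F)" using finite_A by (simp add: of_bool_def sum.If_cases)
    moreover have "A \<inter> F = F" using F by blast
    moreover have "(\<Sum>(u, v)\<in>A \<times> B. of_bool (u \<in> F)) = q * (\<Sum>u\<in>A. of_bool (u \<in> F))"
      using card_B by (simp add: sum.cartesian_product[symmetric] sum_distrib_left)
    ultimately show ?thesis by simp
  qed
  moreover have "(\<Sum>(u, v)\<in>A \<times> B. q) = q * q * q"
    using card_A card_B by (simp add: card_cartesian_product)
  ultimately have K: "(\<Sum>(u, v)\<in>A \<times> B. \<kappa> u v) + q * a = q * q * q + card F * q" by simp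
  have "card F * q + a * q = q * q" using F(2) by (metis distrib_right)
  moreover have "q * (q - 1) + q = q * q" by (cases q) auto
  moreover have "colours None + colours (Some l0) = 2 * q" by (simp add: colours_def)
  moreover have "q * (q\<^sup>2 + 2 * q + 1) = q * q * q + 2 * (q * q) + q"
    by (simp add: power2_eq_square algebra_simps)
  moreover have "2 * a * q = a * q + a * q" "q * a = a * q" by simp_all
  ultimately show ?thesis using K L unfolding sum_index by linarith
qed

lemma psi_bound: "q * (q\<^sup>2 + 2 * q + 1) \<le> psi (card (P \<union> W)) + 2 * a * q"
proof -
  have "(\<Sum>s\<in>insert None (Some ` \<L>). colours s) \<le> psi (card (P \<union> W))"
    by (rule psi_ge_sum_schemes[where E = edges and \<K> = spans and d = debt and g = credit])
      (use finite_points W finite_lines edges_sub edges_disjoint schemes balance spans_meet in auto)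
  then show ?thesis using count by linarith
qed

end

lemma (in framed_plane) psi_bound_frame:
  assumes q: "even q" "q > 0" and W: "finite W" "W \<inter> P = {}" "card W + a = q"
  shows "q * (q\<^sup>2 + 2 * q + 1) \<le> psi (card (P \<union> W)) + 2 * a * q"
proof -
  obtain h where h: "q = 2 * h" using q by (auto elim: evenE)
  have "card W \<le> card A" "a \<le> card B" using card_A card_B W(3) by simp_all
  then obtain F R where F: "F \<subseteq> A" "card F = card W" and R: "R \<subseteq> B" "card R = a"
    by (meson obtain_subset_with_card_n)
  have fin: "finite F" "finite R" using F R finite_A finite_B by (auto intro: finite_subset)
  have AF: "card (A - F) = a" using F fin W card_A by (simp add: card_Diff_subset)
  have "card (B - R) = card W" using R fin W card_B by (simp add: card_Diff_subset)
  then obtain wy where wy: "bij_betw wy (B - R) W"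
    using ex_bij_finite_same_card[of "B - R" W] finite_B W by auto
  obtain wz where wz: "bij_betw wz F W"
    using ex_bij_finite_same_card[of F W] fin F W by auto
  have "a - min a h \<le> card (A - F)" using AF by simp
  then obtain X1 where X1: "X1 \<subseteq> A - F" "card X1 = a - min a h"
    by (meson obtain_subset_with_card_n)
  have "finite X1" using X1 finite_A by (auto intro: finite_subset)
  then have "card (A - F - X1) = a - (a - min a h)" using X1 AF by (simp add: card_Diff_subset)
  then have X1': "card X1 \<le> h" "card (A - F - X1) \<le> h" using X1 W h by auto
  obtain T S where "balanced_loans h F R T S"
    using ex_balanced_loans[OF F(1) R(1), of h] F R W h by auto
  then interpret loan_construction P \<L> q l0 m0 x0 h a W F R X1 wz wy T S
    by unfold_locales (use h q W F R wz wy X1 X1' in auto)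
  show ?thesis by (rule psi_bound)
qed

lemma (in plane_blocks) psi_bound_short:
  assumes q: "even q" "q > 0" and W: "finite W" "W \<inter> P = {}" "card W + a = q"
  shows "q * (q\<^sup>2 + 2 * q + 1) \<le> psi (card (P \<union> W)) + 2 * a * q"
proof -
  have "card \<L> \<noteq> 0" using card_lines by simp
  then obtain l0 where l0: "l0 \<in> \<L>" by fastforce
  then obtain x0 where x0: "x0 \<in> l0" using card_line[of l0] by fastforce
  then have "x0 \<in> P" using line_sub l0 by blast
  then have "card {l \<in> \<L>. x0 \<in> l} > 1" using card_through q by simp
  then have "\<not> {l \<in> \<L>. x0 \<in> l} \<subseteq> {l0}" by (metis card_mono finite.emptyI finite.insertI is_singletonI is_singleton_altdef not_less)
  then obtain m0 where "m0 \<in> \<L>" "x0 \<in> m0" "m0 \<noteq> l0" by blast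
  then interpret framed_plane P \<L> q l0 m0 x0
    by unfold_locales (use l0 x0 in auto)
  show ?thesis using psi_bound_frame[OF q W] .
qed

section \<open>The colouring for a = -1\<close>

lemma (in plane_blocks) psi_bound_long:
  assumes q: "even q" "q > 0" and W: "finite W" "W \<inter> P = {}" "card W = q + 1"
  shows "q * (q\<^sup>2 + 2 * q + 3) \<le> psi (card (P \<union> W))"
proof -
  obtain h where h: "q = 2 * h" "h > 0" using q by (auto elim: evenE)
  obtain w0 where w0: "w0 \<in> W" using W by fastforce
  have "\<exists>f. bij_betw f {l \<in> \<L>. v \<in> l} W" if "v \<in> P" for v
    using ex_bij_finite_same_card[of "{l \<in> \<L>. v \<in> l}" W] finite_lines W card_through[OF that] by auto
  then obtain \<beta> where \<beta>: "\<And>v. v \<in> P \<Longrightarrow> bij_betw (\<beta> v) {l \<in> \<L>. v \<in> l} W" by metis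
  have \<beta>W: "\<beta> v l \<in> W" if "l \<in> \<L>" "v \<in> l" for v l
    using \<beta>[of v] that line_sub[OF that(1)] by (auto simp: bij_betw_def)
  define E where "E s = (case s of None \<Rightarrow> pairs W | Some l \<Rightarrow> pairs l \<union> {{v, \<beta> v l} |v. v \<in> l})" for s
  define k where "k s = (case s of None \<Rightarrow> q - 1 | Some (l::'v set) \<Rightarrow> q + 1)" for s
  define \<K> where "\<K> s = (case s of None \<Rightarrow> {W} | Some l \<Rightarrow> {insert w l |w. w \<in> W})" for s
  define g where "g s v = (case s of None \<Rightarrow> of_bool (v = w0) | Some (l::'v set) \<Rightarrow> (0::nat))" for s v
  have "(\<Sum>s\<in>insert None (Some ` \<L>). k s) \<le> psi (card (P \<union> W))"
  proof (rule psi_ge_sum_schemes[where E = E and \<K> = \<K> and d = "\<lambda>_ _. 0" and g = g])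
    show "E s \<subseteq> pairs (P \<union> W)" if "s \<in> insert None (Some ` \<L>)" for s
    proof (cases s)
      case None
      then show ?thesis using pairs_mono[of W "P \<union> W"] by (auto simp: E_def)
    next
      case (Some l)
      then have l: "l \<in> \<L>" using that by auto
      have "{v, \<beta> v l} \<in> pairs (P \<union> W)" if "v \<in> l" for v
        using \<beta>W[OF l that] line_sub[OF l] that W by auto
      moreover have "pairs l \<subseteq> pairs (P \<union> W)" using line_sub[OF l] by (intro pairs_mono) auto
      ultimately show ?thesis using Some by (auto simp: E_def simp del: doubleton_in_pairs)
    qed
    have ll: "E (Some l) \<inter> E (Some j) = {}" if lj: "l \<in> \<L>" "j \<in> \<L>" "l \<noteq> j" for l j
    proof -
      have "{v, \<beta> v i} \<notin> pairs i'" if "i \<in> \<L>" "i' \<in> \<L>" "v \<in> i" for v i i'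
        using \<beta>W[OF that(1,3)] line_sub[OF that(2)] W by auto
      moreover have "{v, \<beta> v l} \<noteq> {u, \<beta> u j}" if "v \<in> l" "u \<in> j" for u v
      proof
        assume eq: "{v, \<beta> v l} = {u, \<beta> u j}"
        have "v \<in> P" "u \<in> P" using that line_sub lj by blast+
        then have "v = u" "\<beta> v l = \<beta> v j"
          using eq \<beta>W[OF lj(1) that(1)] \<beta>W[OF lj(2) that(2)] W by (auto simp: doubleton_eq_iff)
        then show False
          using \<beta>[OF \<open>v \<in> P\<close>] lj that by (auto simp: bij_betw_def inj_on_def)
      qed
      ultimately show ?thesis
        using pairs_lines_disjoint[OF lj] lj by (auto simp: E_def)
    qed
    have nl: "E None \<inter> E (Some l) = {}" if l: "l \<in> \<L>" for l
    proof -
      have "{v, \<beta> v l} \<notin> pairs W" if "v \<in> l" for v using line_sub[OF l] that W by auto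
      moreover have "pairs W \<inter> pairs l = {}"
      proof -
        have "W \<inter> l = {}" using line_sub[OF l] W by blast
        then have "e \<notin> pairs l" if "e \<in> pairs W" for e using that by (elim pairsE) auto
        then show ?thesis by blast
      qed
      ultimately show ?thesis by (auto simp: E_def)
    qed
    show "disjoint_family_on E (insert None (Some ` \<L>))"
      using ll nl by (rule disjoint_family_on_optionI)
    show "scheme (E s) (k s) (\<K> s) (\<lambda>_. 0) (g s)" if "s \<in> insert None (Some ` \<L>)" for s
    proof (cases s)
      case None
      have "scheme (pairs W) (2*h - 1) {W} (\<lambda>_. 0) (\<lambda>v. of_bool (v = w0))"
        using W h w0 by (intro scheme_edge_covers) auto
      then show ?thesis using None h by (simp add: E_def k_def \<K>_def g_def[abs_def])
    next
      case (Some l)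
      then have l: "l \<in> \<L>" using that by auto
      have "scheme (pairs l \<union> {{v, \<beta> v l} |v. v \<in> l}) (card l) {insert (\<beta> v l) l |v. v \<in> l} (\<lambda>_. 0) (\<lambda>_. 0)"
        using finite_line[OF l] card_line[OF l] q \<beta>W[OF l] line_sub[OF l] W
        by (intro scheme_full) auto
      then have "scheme (E s) (k s) {insert (\<beta> v l) l |v. v \<in> l} (\<lambda>_. 0) (g s)"
        using Some card_line[OF l] by (simp add: E_def k_def g_def[abs_def])
      then show ?thesis
        by (rule scheme_mono) (use Some \<beta>W[OF l] in \<open>auto simp: \<K>_def\<close>)
    qed
    show "U \<inter> V \<noteq> {}"
      if "s \<in> insert None (Some ` \<L>)" "t \<in> insert None (Some ` \<L>)" "U \<in> \<K> s" "V \<in> \<K> t" for s t U V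
      using that w0 lines_meet by (cases s; cases t) (auto simp: \<K>_def)
  qed (use finite_points W finite_lines in auto)
  moreover have "(\<Sum>s\<in>insert None (Some ` \<L>). k s) = (q - 1) + card \<L> * (q + 1)"
    using finite_lines by (simp add: sum.reindex k_def)
  moreover have "(q - 1) + card \<L> * (q + 1) = q * (q\<^sup>2 + 2 * q + 3)"
    using card_lines q by (simp add: power2_eq_square algebra_simps)
  ultimately show ?thesis by simp
qed

section \<open>The lower bound\<close>

text \<open>Lines are replaced by their point sets, and points are embedded into a sum type that leaves room
  for the vertices outside the plane. As \<open>q > 0\<close>, different lines have different point sets.\<close>

lemma plane_blocks_of_projective_plane:
  fixes points :: "'p set" and lines :: "'l set"
  assumes plane: "projective_plane_of_order points lines incident q" and q: "q > 0"
  shows "plane_blocks (Inl ` points :: ('p + nat) set)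
    ((\<lambda>l. Inl ` {x \<in> points. incident x l}) ` lines) q"
proof -
  interpret projective_plane_of_order points lines incident q by (rule plane)
  define block :: "'l \<Rightarrow> ('p + nat) set" where "block l = Inl ` {x \<in> points. incident x l}" for l
  have card_block: "card (block l) = q + 1" if "l \<in> lines" for l
    using points_on_line[OF that] by (simp add: block_def card_image)
  have meet: "\<exists>!x. x \<in> block l \<and> x \<in> block k" if lk: "l \<in> lines" "k \<in> lines" "l \<noteq> k" for l k
  proof -
    obtain x where x: "x \<in> points" "incident x l" "incident x k"
      and uniq: "\<And>y. y \<in> points \<Longrightarrow> incident y l \<Longrightarrow> incident y k \<Longrightarrow> y = x"
      using ex1_implies_ex[OF meeting_point[OF lk]] ex1_iff_ex_Uniq[THEN iffD1, OF meeting_point[OF lk]]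
      unfolding Uniq_def by meson
    show ?thesis
    proof (rule ex1I)
      show "Inl x \<in> block l \<and> Inl x \<in> block k" using x by (simp add: block_def)
      fix y assume "y \<in> block l \<and> y \<in> block k"
      then show "y = Inl x" using uniq by (auto simp: block_def)
    qed
  qed
  have inj: "inj_on block lines"
  proof (rule inj_onI, rule ccontr)
    fix l k assume lk: "l \<in> lines" "k \<in> lines" "block l = block k" "l \<noteq> k"
    then obtain x where "block l \<subseteq> {x}" using meet[OF lk(1,2,4)] by blast
    then have "card (block l) \<le> 1" by (metis card.empty card_mono card_insert_if finite.emptyI finite.insertI is_singletonI is_singleton_altdef)
    then show False using card_block[OF lk(1)] q by simp
  qed
  have "plane_blocks (Inl ` points :: ('p + nat) set) (block ` lines) q"
  proof
    show "finite (Inl ` points :: ('p + nat) set)"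
      using card_points by (intro finite_imageI card_ge_0_finite) simp
    show "l \<subseteq> Inl ` points" if "l \<in> block ` lines" for l using that by (auto simp: block_def)
    show "card l = q + 1" if "l \<in> block ` lines" for l using that card_block by auto
    show "\<exists>l\<in>block ` lines. x \<in> l \<and> y \<in> l"
      if xy: "x \<in> Inl ` points" "y \<in> Inl ` points" "x \<noteq> y" for x y
    proof -
      obtain u v where uv: "x = Inl u" "y = Inl v" "u \<in> points" "v \<in> points" "u \<noteq> v" using xy by auto
      then obtain l where "l \<in> lines" "incident u l" "incident v l" using joining_line by blast
      then show ?thesis using uv by (intro bexI[of _ "block l"]) (auto simp: block_def)
    qed
    show "\<exists>!x. x \<in> l \<and> x \<in> k"
      if lk: "l \<in> block ` lines" "k \<in> block ` lines" "l \<noteq> k" for l k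
    proof -
      obtain l' k' where "l = block l'" "k = block k'" "l' \<in> lines" "k' \<in> lines"
        using lk(1,2) by auto
      then show ?thesis using meet[of l' k'] lk(3) by auto
    qed
    show "card {l \<in> block ` lines. x \<in> l} = q + 1" if x: "x \<in> Inl ` points" for x
    proof -
      obtain u where u: "x = Inl u" "u \<in> points" using x by auto
      then have "{l \<in> block ` lines. x \<in> l} = block ` {l \<in> lines. incident u l}"
        by (auto simp: block_def)
      then have "card {l \<in> block ` lines. x \<in> l} = card {l \<in> lines. incident u l}"
        using inj by (simp add: card_image inj_on_subset)
      then show ?thesis using lines_through_point[OF u(2)] by simp
    qed
    show "card (block ` lines) = q\<^sup>2 + q + 1" using inj card_lines by (simp add: card_image)
  qed
  then show ?thesis by (simp add: block_def[abs_def])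
qed

theorem theorem2:
  fixes q n m :: nat and a :: int
    and points :: "'p set" and lines :: "'l set" and incident :: "'p \<Rightarrow> 'l \<Rightarrow> bool"
  assumes "q \<ge> 4" and "even q"
    and "n = q^2 + q + 1"
    and "a \<in> {-1..int q div 2 + 1}"
    and "int m = int n + int q - a"
    and "projective_plane_of_order points lines incident q"
  shows "int (psi m) \<ge> (int m - a) * int q"
proof -
  define P :: "('p + nat) set" where "P = Inl ` points"
  have q: "even q" "q > 0" using assms by auto
  interpret plane_blocks P "(\<lambda>l. Inl ` {x \<in> points. incident x l}) ` lines" q
    unfolding P_def by (rule plane_blocks_of_projective_plane[OF assms(6) q(2)])
  define W :: "('p + nat) set" where "W = Inr ` {..<nat (int q - a)}"
  have "a \<le> int q" using assms by auto
  then have W: "finite W" "W \<inter> P = {}" "int (card W) = int q - a"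
    by (auto simp: W_def P_def card_image)
  have "card P = n"
    using assms(3) projective_plane_of_order.card_points[OF assms(6)] by (simp add: P_def card_image)
  then have "int (card (P \<union> W)) = int m"
    using W assms(5) finite_points by (subst card_Un_disjoint) auto
  then have m: "card (P \<union> W) = m" by simp
  have m_eq: "int m = (int q)\<^sup>2 + 2 * int q + 1 - a" using assms(3,5) by simp
  show ?thesis
  proof (cases "a = -1")
    case True
    have "q * (q\<^sup>2 + 2 * q + 3) \<le> psi m"
      using psi_bound_long[OF q W(1,2)] W(3) True m by simp
    then have "int (q * (q\<^sup>2 + 2 * q + 3)) \<le> int (psi m)" by (simp only: of_nat_le_iff)
    then show ?thesis using True by (simp add: m_eq algebra_simps)
  next
    case False
    then have a: "int (nat a) = a" using assms(4) by simp
    have "card W + nat a = q" using W(3) a by linarith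
    then have "q * (q\<^sup>2 + 2 * q + 1) \<le> psi m + 2 * nat a * q"
      using psi_bound_short[OF q W(1,2)] m by simp
    then have "int (q * (q\<^sup>2 + 2 * q + 1)) \<le> int (psi m + 2 * nat a * q)" by (simp only: of_nat_le_iff)
    then show ?thesis using a by (simp add: m_eq algebra_simps)
  qed
qed

end
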